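(* Let $(V,G)$ be a finite pseudo reflection group, $\Upsilon=\{\mu_s\}_{s\in R}\cup\{m_i\}_{i\in P}$ admissible complex parameters, $\kappa\in\mathbb{C}$, and let $\rho:B_G(\Upsilon)\to\mathrm{End}(E)$ be a finite dimensional representation. Then the connection $$\Omega_\rho=\kappa\sum_{i\in P}\Big(\sum_{s\in R:\,\ker(s-1)=H_i}\mu_s\rho(s)-\rho(e_i)\Big)\omega_i$$ on the trivial bundle $E\times M_G$ is flat and $G$-invariant, where $G$ acts on $E\times M_G$ by $w\cdot(u,x)=(\rho(w)u,wx)$.
   Context: A pseudo reflection of a finite dimensional complex vector space $V$ is a non-identity element of $GL(V)$ of finite order fixing pointwise a hyperplane; a finite pseudo reflection group $(V,G)$ is a finite subgroup $G\subset GL(V)$ generated by pseudo reflections. $R$ is the set of pseudo reflections in $G$; $\{H_i\}_{i\in P}$ is the set of their fixed hyperplanes, indexed bijectively by $P$. $G$ acts on $P$ by $w(H_i)=H_{w(i)}$. For $i,j\in P$ put $R(i,j)=\{s\in R: s(H_j)=H_i\}$. Admissible parameters: $\mu_s\in\mathbb{C}$ ($s\in R$) with $\mu_{s_1}=\mu_{s_2}$ if $s_1,s_2$ are conjugate in $G$, and $m_i\in\mathbb{C}$ ($i\in P$) with $m_i=m_j$ if $w(H_i)=H_j$ for some $w\in G$. $B_G(\Upsilon)$ is the unital associative $\mathbb{C}$-algebra generated by $\{\bar w\}_{w\in G}\cup\{e_i\}_{i\in P}$ with relations: (0) $\bar w_1\bar w_2=\bar w_3$ if $w_1w_2=w_3$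 in $G$ (and $\bar 1$ is the unit); (1) $\bar s_ie_i=e_i\bar s_i=e_i$ for $i\in P$ and any pseudo reflection $s_i\in G$ with reflection hyperplane $H_i$; (2) $e_i^2=m_ie_i$; (3) $\bar we_j=e_i\bar w$ if $w\in G$ satisfies $w(H_j)=H_i$; and for $i\ne j$: (4) $e_ie_j=e_je_i$ if $\{k\in P: H_k\supset H_i\cap H_j\}=\{i,j\}$; (5) $e_ie_j=\big(\sum_{s\in R(i,j)}\mu_s\bar s\big)e_j$ if $\{k\in P: H_k\supset H_i\cap H_j\}\ne\{i,j\}$ and $R(i,j)\neq\emptyset$; (6) $e_ie_j=0$ if $\{k\in P: H_k\supset H_i\cap H_j\}\neq\{i,j\}$ and $R(i,j)=\emptyset$. We write $w$ for $\bar w$. $M_G=V\setminus\bigcup_{i\in P}H_i$, and $\omega_i=d\log f_i$ with $f_i$ a nonzero linear form with kernel $H_i$. A connection $\Omega=\sum_iX_i\omega_i$ on the trivial bundle (flat sections: $d\Phi=\Omega\Phi$) is flat if $d\Omega-\Omega\wedge\Omega=0$; it is $G$-invariant if and only if $X_{w(i)}=\rho(w)X_i\rho(w)^{-1}$ for all $w\in G$, $i\in P$. *)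

theory Defs
  imports "HOL-Analysis.Analysis" "HOL-Algebra.QuotRing" "HOL-Algebra.Generated_Groups"
begin

section \<open>Finite dimensional complex vector spaces\<close>

text \<open>
  The norm is auxiliary: it only serves to make the library notion of derivative available.
  Every finite dimensional complex vector space carries one, and all of them are equivalent.
  Dimension zero is allowed.
\<close>

locale fin_dim_complex_space = finite_dimensional_vector_space scaleV B
  for scaleV :: "complex \<Rightarrow> 'a::real_normed_vector \<Rightarrow> 'a" and B :: "'a set" +
  assumes scale_of_real: "scaleV (complex_of_real r) x = r *\<^sub>R x"

definition GL :: "(complex \<Rightarrow> 'v::ab_group_add \<Rightarrow> 'v) \<Rightarrow> ('v \<Rightarrow> 'v) monoid" where
  "GL scaleV = \<lparr>carrier = {g. Vector_Spaces.linear scaleV scaleV g \<and> bij g}, mult = (\<circ>), one = id\<rparr>"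

definition End_ring :: "(complex \<Rightarrow> 'e::ab_group_add \<Rightarrow> 'e) \<Rightarrow> ('e \<Rightarrow> 'e) ring" where
  "End_ring scaleE = \<lparr>carrier = {A. Vector_Spaces.linear scaleE scaleE A},
     mult = (\<circ>), one = id, zero = (\<lambda>_. 0), add = (\<lambda>A B x. A x + B x)\<rparr>"

definition hyperplane :: "(complex \<Rightarrow> 'v::ab_group_add \<Rightarrow> 'v) \<Rightarrow> 'v set \<Rightarrow> bool" where
  "hyperplane scaleV H \<longleftrightarrow> module.subspace scaleV H \<and>
     vector_space.dim scaleV (UNIV :: 'v set) = Suc (vector_space.dim scaleV H)"


section \<open>Pseudo reflection groups\<close>

definition pseudo_reflection :: "(complex \<Rightarrow> 'v::ab_group_add \<Rightarrow> 'v) \<Rightarrow> ('v \<Rightarrow> 'v) \<Rightarrow> bool" where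
  "pseudo_reflection scaleV s \<longleftrightarrow> s \<in> carrier (GL scaleV) \<and> s \<noteq> id \<and> (\<exists>n>0. s ^^ n = id) \<and>
     (\<exists>H. hyperplane scaleV H \<and> (\<forall>x\<in>H. s x = x))"

definition reflections :: "(complex \<Rightarrow> 'v::ab_group_add \<Rightarrow> 'v) \<Rightarrow> ('v \<Rightarrow> 'v) set \<Rightarrow> ('v \<Rightarrow> 'v) set" where
  "reflections scaleV G = {s \<in> G. pseudo_reflection scaleV s}"

definition pseudo_reflection_group ::
  "(complex \<Rightarrow> 'v::ab_group_add \<Rightarrow> 'v) \<Rightarrow> ('v \<Rightarrow> 'v) set \<Rightarrow> bool" where
  "pseudo_reflection_group scaleV G \<longleftrightarrow> finite G \<and> subgroup G (GL scaleV) \<and>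
     generate (GL scaleV) (reflections scaleV G) = G"

text \<open>The kernel of \<open>s - 1\<close>; for a pseudo reflection this is its reflection hyperplane.\<close>

definition fixed_space :: "('v \<Rightarrow> 'v) \<Rightarrow> 'v set" where
  "fixed_space s = {x. s x = x}"

text \<open>
  \<open>H\<close> indexes the reflection hyperplanes bijectively by \<open>P\<close>. The action of \<open>G\<close> on \<open>P\<close> is
  expressed throughout as \<open>w ` H j = H i\<close>.
\<close>

definition indexes_hyperplanes ::
  "(complex \<Rightarrow> 'v::ab_group_add \<Rightarrow> 'v) \<Rightarrow> ('v \<Rightarrow> 'v) set \<Rightarrow> 'p set \<Rightarrow> ('p \<Rightarrow> 'v set) \<Rightarrow> bool" where
  "indexes_hyperplanes scaleV G P H \<longleftrightarrow> bij_betw H P (fixed_space ` reflections scaleV G)"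

definition admissible ::
  "(complex \<Rightarrow> 'v::ab_group_add \<Rightarrow> 'v) \<Rightarrow> ('v \<Rightarrow> 'v) set \<Rightarrow> 'p set \<Rightarrow> ('p \<Rightarrow> 'v set) \<Rightarrow>
    (('v \<Rightarrow> 'v) \<Rightarrow> complex) \<Rightarrow> ('p \<Rightarrow> complex) \<Rightarrow> bool" where
  "admissible scaleV G P H \<mu> m \<longleftrightarrow>
     (\<forall>s\<^sub>1\<in>reflections scaleV G. \<forall>s\<^sub>2\<in>reflections scaleV G.
        (\<exists>w\<in>G. s\<^sub>2 = w \<circ> s\<^sub>1 \<circ> inv_into UNIV w) \<longrightarrow> \<mu> s\<^sub>1 = \<mu> s\<^sub>2) \<and>
     (\<forall>i\<in>P. \<forall>j\<in>P. (\<exists>w\<in>G. w ` H i = H j) \<longrightarrow> m i = m j)"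

definition complement :: "'p set \<Rightarrow> ('p \<Rightarrow> 'v set) \<Rightarrow> 'v set" where
  "complement P H = UNIV - (\<Union>i\<in>P. H i)"

definition refl_between ::
  "(complex \<Rightarrow> 'v::ab_group_add \<Rightarrow> 'v) \<Rightarrow> ('v \<Rightarrow> 'v) set \<Rightarrow> ('p \<Rightarrow> 'v set) \<Rightarrow> 'p \<Rightarrow> 'p \<Rightarrow> ('v \<Rightarrow> 'v) set" where
  "refl_between scaleV G H i j = {s \<in> reflections scaleV G. s ` H j = H i}"

definition hyperplanes_above :: "'p set \<Rightarrow> ('p \<Rightarrow> 'v set) \<Rightarrow> 'p \<Rightarrow> 'p \<Rightarrow> 'p set" where
  "hyperplanes_above P H i j = {k \<in> P. H i \<inter> H j \<subseteq> H k}"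


section \<open>Free associative algebras\<close>

text \<open>
  Noncommutative polynomials over \<open>\<complex>\<close> in the letters \<open>X\<close>: finitely supported functions on the
  words over \<open>X\<close>, multiplied by concatenation of words.
\<close>

definition free_algebra :: "'x set \<Rightarrow> ('x list \<Rightarrow> complex) ring" where
  "free_algebra X = \<lparr>carrier = {a. finite {u. a u \<noteq> 0} \<and> {u. a u \<noteq> 0} \<subseteq> lists X},
     mult = (\<lambda>a b u. \<Sum>k\<le>length u. a (take k u) * b (drop k u)),
     one = (\<lambda>u. if u = [] then 1 else 0),
     zero = (\<lambda>_. 0),
     add = (\<lambda>a b u. a u + b u)\<rparr>"

definition word_elem :: "'x list \<Rightarrow> 'x list \<Rightarrow> complex" where
  "word_elem u = (\<lambda>v. if v = u then 1 else 0)"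

lemma word_elem_carrier: "u \<in> lists X \<Longrightarrow> word_elem u \<in> carrier (free_algebra X)"
  by (auto simp: word_elem_def free_algebra_def)

lemma word_elem_mult: "word_elem u \<otimes>\<^bsub>free_algebra X\<^esub> word_elem v = word_elem (u @ v)"
proof
  fix w :: "'a list"
  have "(\<Sum>k\<le>length w. word_elem u (take k w) * word_elem v (drop k w)) =
        (\<Sum>k\<le>length w. if k = length u \<and> w = u @ v then 1 else 0)"
    by (intro sum.cong refl) (auto simp: word_elem_def append_eq_conv_conj)
  also have "\<dots> = word_elem (u @ v) w"
    by (cases "w = u @ v") (auto simp: word_elem_def)
  finally show "(word_elem u \<otimes>\<^bsub>free_algebra X\<^esub> word_elem v) w = word_elem (u @ v) w"
    by (simp add: free_algebra_def)
qed

lemma ring_free_algebra: "ring (free_algebra X)"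
proof (rule ringI)
  let ?F = "free_algebra X"
  have add_closed: "(\<lambda>u. a u + b u) \<in> carrier ?F" if "a \<in> carrier ?F" "b \<in> carrier ?F" for a b
  proof -
    have "{u. a u + b u \<noteq> 0} \<subseteq> {u. a u \<noteq> 0} \<union> {u. b u \<noteq> 0}" by auto
    then show ?thesis using that unfolding free_algebra_def
      by (auto intro: finite_subset)
  qed
  show "abelian_group ?F"
  proof (rule abelian_groupI)
    fix a assume a: "a \<in> carrier ?F"
    show "\<exists>b\<in>carrier ?F. b \<oplus>\<^bsub>?F\<^esub> a = \<zero>\<^bsub>?F\<^esub>"
      by (rule bexI[of _ "\<lambda>u. - a u"]) (use a in \<open>auto simp: free_algebra_def\<close>)
  qed (use add_closed in \<open>auto simp: free_algebra_def fun_eq_iff\<close>)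
  show "Group.monoid ?F"
  proof (rule monoidI)
    fix a b assume ab: "a \<in> carrier ?F" "b \<in> carrier ?F"
    have sub: "{u. (\<Sum>k\<le>length u. a (take k u) * b (drop k u)) \<noteq> 0} \<subseteq>
          (\<lambda>(x, y). x @ y) ` ({u. a u \<noteq> 0} \<times> {u. b u \<noteq> 0})"
    proof
      fix u assume "u \<in> {u. (\<Sum>k\<le>length u. a (take k u) * b (drop k u)) \<noteq> 0}"
      then obtain k where "a (take k u) * b (drop k u) \<noteq> 0"
        by (metis (mono_tags, lifting) mem_Collect_eq sum.neutral)
      then show "u \<in> (\<lambda>(x, y). x @ y) ` ({u. a u \<noteq> 0} \<times> {u. b u \<noteq> 0})"
        by (intro image_eqI[of _ _ "(take k u, drop k u)"]) auto
    qed
    have fin: "finite ((\<lambda>(x, y). x @ y) ` ({u. a u \<noteq> 0} \<times> {u. b u \<noteq> 0}))"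
      using ab by (simp add: free_algebra_def)
    have wrd: "(\<lambda>(x, y). x @ y) ` ({u. a u \<noteq> 0} \<times> {u. b u \<noteq> 0}) \<subseteq> lists X"
      using ab by (fastforce simp: free_algebra_def)
    show "a \<otimes>\<^bsub>?F\<^esub> b \<in> carrier ?F"
      using finite_subset[OF sub fin] subset_trans[OF sub wrd] unfolding free_algebra_def by simp
  next
    fix a b c
    show "a \<otimes>\<^bsub>?F\<^esub> b \<otimes>\<^bsub>?F\<^esub> c = a \<otimes>\<^bsub>?F\<^esub> (b \<otimes>\<^bsub>?F\<^esub> c)"
    proof
      fix u :: "'a list"
      let ?n = "length u"
      define f where "f i j r = a (take i u) * b (take j (drop i u)) * c (drop (?n - r) u)" for i j r
      have "(a \<otimes>\<^bsub>?F\<^esub> b \<otimes>\<^bsub>?F\<^esub> c) u = (\<Sum>k=0..?n. \<Sum>i=0..k. f i (k - i) (?n - k))"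
        unfolding free_algebra_def atLeast0AtMost
        by (auto simp: f_def sum_distrib_right min_def drop_take intro!: sum.cong)
      also have "\<dots> = (\<Sum>i=0..?n. \<Sum>j=0..?n - i. f i j (?n - i - j))"
        by (rule fps_mult_assoc_lemma)
      also have "\<dots> = (a \<otimes>\<^bsub>?F\<^esub> (b \<otimes>\<^bsub>?F\<^esub> c)) u"
        unfolding free_algebra_def atLeast0AtMost
        by (auto simp: f_def sum_distrib_left mult.assoc add.commute intro!: sum.cong)
      finally show "(a \<otimes>\<^bsub>?F\<^esub> b \<otimes>\<^bsub>?F\<^esub> c) u = (a \<otimes>\<^bsub>?F\<^esub> (b \<otimes>\<^bsub>?F\<^esub> c)) u" .
    qed
  next
    fix a
    show "\<one>\<^bsub>?F\<^esub> \<otimes>\<^bsub>?F\<^esub> a = a"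
    proof
      fix u :: "'a list"
      have "(\<Sum>k\<le>length u. (if take k u = [] then 1 else 0) * a (drop k u)) =
            (\<Sum>k\<le>length u. if k = 0 then a u else 0)"
        by (intro sum.cong) auto
      then show "(\<one>\<^bsub>?F\<^esub> \<otimes>\<^bsub>?F\<^esub> a) u = a u"
        unfolding free_algebra_def by (simp del: take_eq_Nil)
    qed
    show "a \<otimes>\<^bsub>?F\<^esub> \<one>\<^bsub>?F\<^esub> = a"
    proof
      fix u :: "'a list"
      have "(\<Sum>k\<le>length u. a (take k u) * (if drop k u = [] then 1 else 0)) =
            (\<Sum>k\<le>length u. if k = length u then a u else 0)"
        by (intro sum.cong) auto
      then show "(a \<otimes>\<^bsub>?F\<^esub> \<one>\<^bsub>?F\<^esub>) u = a u"
        unfolding free_algebra_def by (simp del: drop_eq_Nil)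
    qed
  qed (auto simp: free_algebra_def)
qed (auto simp: free_algebra_def fun_eq_iff distrib_left distrib_right sum.distrib)


section \<open>The algebra \<open>B\<^sub>G(\<Upsilon>)\<close>\<close>

text \<open>The letter \<open>Grp w\<close> stands for the generator of a group element, \<open>Hyp i\<close> for \<open>e\<^sub>i\<close>.\<close>

datatype ('g, 'p) letter = Grp 'g | Hyp 'p

definition letters :: "'g set \<Rightarrow> 'p set \<Rightarrow> ('g, 'p) letter set" where
  "letters G P = Grp ` G \<union> Hyp ` P"

text \<open>\<open>brauer_relation \<dots> a b\<close> says that \<open>a = b\<close> is one of the defining relations.\<close>

inductive brauer_relation ::
  "(complex \<Rightarrow> 'v::ab_group_add \<Rightarrow> 'v) \<Rightarrow> ('v \<Rightarrow> 'v) set \<Rightarrow> 'p set \<Rightarrow> ('p \<Rightarrow> 'v set) \<Rightarrow>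
    (('v \<Rightarrow> 'v) \<Rightarrow> complex) \<Rightarrow> ('p \<Rightarrow> complex) \<Rightarrow>
    (('v \<Rightarrow> 'v, 'p) letter list \<Rightarrow> complex) \<Rightarrow> (('v \<Rightarrow> 'v, 'p) letter list \<Rightarrow> complex) \<Rightarrow> bool"
  for scaleV G P H \<mu> m where
  group_mult: "\<lbrakk>w\<^sub>1 \<in> G; w\<^sub>2 \<in> G\<rbrakk> \<Longrightarrow>
    brauer_relation scaleV G P H \<mu> m (word_elem [Grp w\<^sub>1, Grp w\<^sub>2]) (word_elem [Grp (w\<^sub>1 \<circ> w\<^sub>2)])"
| group_one:
    "brauer_relation scaleV G P H \<mu> m (word_elem [Grp id]) (word_elem [])"
| refl_left: "\<lbrakk>i \<in> P; s \<in> reflections scaleV G; fixed_space s = H i\<rbrakk> \<Longrightarrow>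
    brauer_relation scaleV G P H \<mu> m (word_elem [Grp s, Hyp i]) (word_elem [Hyp i])"
| refl_right: "\<lbrakk>i \<in> P; s \<in> reflections scaleV G; fixed_space s = H i\<rbrakk> \<Longrightarrow>
    brauer_relation scaleV G P H \<mu> m (word_elem [Hyp i, Grp s]) (word_elem [Hyp i])"
| square: "i \<in> P \<Longrightarrow>
    brauer_relation scaleV G P H \<mu> m (word_elem [Hyp i, Hyp i]) (\<lambda>u. m i * word_elem [Hyp i] u)"
| equivariant: "\<lbrakk>w \<in> G; i \<in> P; j \<in> P; w ` H j = H i\<rbrakk> \<Longrightarrow>
    brauer_relation scaleV G P H \<mu> m (word_elem [Grp w, Hyp j]) (word_elem [Hyp i, Grp w])"
| commute: "\<lbrakk>i \<in> P; j \<in> P; i \<noteq> j; hyperplanes_above P H i j = {i, j}\<rbrakk> \<Longrightarrow>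
    brauer_relation scaleV G P H \<mu> m (word_elem [Hyp i, Hyp j]) (word_elem [Hyp j, Hyp i])"
| product_refl: "\<lbrakk>i \<in> P; j \<in> P; i \<noteq> j; hyperplanes_above P H i j \<noteq> {i, j};
      refl_between scaleV G H i j \<noteq> {}\<rbrakk> \<Longrightarrow>
    brauer_relation scaleV G P H \<mu> m (word_elem [Hyp i, Hyp j])
      (\<lambda>u. \<Sum>s\<in>refl_between scaleV G H i j. \<mu> s * word_elem [Grp s, Hyp j] u)"
| product_zero: "\<lbrakk>i \<in> P; j \<in> P; i \<noteq> j; hyperplanes_above P H i j \<noteq> {i, j};
      refl_between scaleV G H i j = {}\<rbrakk> \<Longrightarrow>
    brauer_relation scaleV G P H \<mu> m (word_elem [Hyp i, Hyp j]) (\<lambda>_. 0)"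

definition brauer_ideal ::
  "(complex \<Rightarrow> 'v::ab_group_add \<Rightarrow> 'v) \<Rightarrow> ('v \<Rightarrow> 'v) set \<Rightarrow> 'p set \<Rightarrow> ('p \<Rightarrow> 'v set) \<Rightarrow>
    (('v \<Rightarrow> 'v) \<Rightarrow> complex) \<Rightarrow> ('p \<Rightarrow> complex) \<Rightarrow> (('v \<Rightarrow> 'v, 'p) letter list \<Rightarrow> complex) set" where
  "brauer_ideal scaleV G P H \<mu> m =
     genideal (free_algebra (letters G P)) {\<lambda>u. a u - b u |a b. brauer_relation scaleV G P H \<mu> m a b}"

definition brauer_algebra ::
  "(complex \<Rightarrow> 'v::ab_group_add \<Rightarrow> 'v) \<Rightarrow> ('v \<Rightarrow> 'v) set \<Rightarrow> 'p set \<Rightarrow> ('p \<Rightarrow> 'v set) \<Rightarrow>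
    (('v \<Rightarrow> 'v) \<Rightarrow> complex) \<Rightarrow> ('p \<Rightarrow> complex) \<Rightarrow> (('v \<Rightarrow> 'v, 'p) letter list \<Rightarrow> complex) set ring" where
  "brauer_algebra scaleV G P H \<mu> m =
     free_algebra (letters G P) Quot brauer_ideal scaleV G P H \<mu> m"

definition brauer_class ::
  "(complex \<Rightarrow> 'v::ab_group_add \<Rightarrow> 'v) \<Rightarrow> ('v \<Rightarrow> 'v) set \<Rightarrow> 'p set \<Rightarrow> ('p \<Rightarrow> 'v set) \<Rightarrow>
    (('v \<Rightarrow> 'v) \<Rightarrow> complex) \<Rightarrow> ('p \<Rightarrow> complex) \<Rightarrow> (('v \<Rightarrow> 'v, 'p) letter list \<Rightarrow> complex) \<Rightarrow>
    (('v \<Rightarrow> 'v, 'p) letter list \<Rightarrow> complex) set" where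
  "brauer_class scaleV G P H \<mu> m a =
     brauer_ideal scaleV G P H \<mu> m +>\<^bsub>free_algebra (letters G P)\<^esub> a"

text \<open>
  The relators lie in the free algebra, so that \<^const>\<open>brauer_ideal\<close> is the two-sided ideal they
  generate (\<^const>\<open>genideal\<close> is only meaningful for subsets of the carrier).
\<close>

lemma relators_in_carrier:
  assumes "finite G" "subgroup G (GL scaleV)"
  shows "{\<lambda>u. a u - b u |a b. brauer_relation scaleV G P H \<mu> m a b} \<subseteq>
    carrier (free_algebra (letters G P))"
proof -
  let ?C = "carrier (free_algebra (letters G P))"
  have diff: "(\<lambda>u. a u - b u) \<in> ?C" if "a \<in> ?C" "b \<in> ?C" for a b
  proof -
    have "{u. a u - b u \<noteq> 0} \<subseteq> {u. a u \<noteq> 0} \<union> {u. b u \<noteq> 0}" by auto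
    then show ?thesis using that unfolding free_algebra_def
      by (auto intro: finite_subset)
  qed
  have smult: "(\<lambda>u. c * a u) \<in> ?C" if "a \<in> ?C" for c a
    using that unfolding free_algebra_def
    by (auto intro: finite_subset[of _ "{u. a u \<noteq> 0}"])
  have zero: "(\<lambda>_. 0) \<in> ?C" by (simp add: free_algebra_def)
  have sum: "(\<lambda>u. \<Sum>s\<in>S. F s u) \<in> ?C" if "finite S" "\<And>s. s \<in> S \<Longrightarrow> F s \<in> ?C" for S :: "('a \<Rightarrow> 'a) set" and F
    using that
  proof (induction S rule: finite_induct)
    case empty
    then show ?case using zero by simp
  next
    case (insert s S)
    then have "(\<lambda>u. F s u - (- 1) * (\<Sum>s\<in>S. F s u)) \<in> ?C"
      by (intro diff smult) auto
    with insert show ?case by simp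
  qed
  have G: "id \<in> G" "\<And>g h. g \<in> G \<Longrightarrow> h \<in> G \<Longrightarrow> g \<circ> h \<in> G"
    using subgroup.one_closed[OF assms(2)] subgroup.m_closed[OF assms(2)] by (auto simp: GL_def)
  have R: "finite (refl_between scaleV G H i j)" "refl_between scaleV G H i j \<subseteq> G"
    "reflections scaleV G \<subseteq> G" for i j
    using assms(1) by (auto simp: refl_between_def reflections_def)
  have L: "Grp g \<in> letters G P \<longleftrightarrow> g \<in> G" "Hyp i \<in> letters G P \<longleftrightarrow> i \<in> P" for g i
    by (auto simp: letters_def)
  have "a \<in> ?C \<and> b \<in> ?C" if "brauer_relation scaleV G P H \<mu> m a b" for a b
    using that
  proof cases
    case (product_refl i j)
    have "b \<in> ?C" unfolding product_refl(2)
      by (rule sum[OF R(1)], rule smult, rule word_elem_carrier)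
        (use R(2)[of i j] product_refl(4) in \<open>auto simp: L\<close>)
    moreover have "a \<in> ?C" unfolding product_refl(1)
      by (rule word_elem_carrier) (use product_refl(3,4) in \<open>auto simp: L\<close>)
    ultimately show ?thesis by simp
  qed (use G R(3) in \<open>auto simp: L subset_eq intro!: word_elem_carrier smult zero\<close>)
  then show ?thesis using diff by blast
qed

text \<open>
  A representation is a homomorphism of unital \<open>\<complex>\<close>-algebras into \<open>End(E)\<close>: a unital ring
  homomorphism compatible with the structure maps from \<open>\<complex>\<close>.
\<close>

definition brauer_representation ::
  "(complex \<Rightarrow> 'v::ab_group_add \<Rightarrow> 'v) \<Rightarrow> ('v \<Rightarrow> 'v) set \<Rightarrow> 'p set \<Rightarrow> ('p \<Rightarrow> 'v set) \<Rightarrow>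
    (('v \<Rightarrow> 'v) \<Rightarrow> complex) \<Rightarrow> ('p \<Rightarrow> complex) \<Rightarrow> (complex \<Rightarrow> 'e::ab_group_add \<Rightarrow> 'e) \<Rightarrow>
    ((('v \<Rightarrow> 'v, 'p) letter list \<Rightarrow> complex) set \<Rightarrow> 'e \<Rightarrow> 'e) \<Rightarrow> bool" where
  "brauer_representation scaleV G P H \<mu> m scaleE \<rho> \<longleftrightarrow>
     \<rho> \<in> ring_hom (brauer_algebra scaleV G P H \<mu> m) (End_ring scaleE) \<and>
     (\<forall>c. \<rho> (brauer_class scaleV G P H \<mu> m (\<lambda>u. c * word_elem [] u)) = scaleE c)"


section \<open>Connections on trivial bundles\<close>

text \<open>
  A connection on the trivial bundle with fibre \<open>E\<close> over \<open>M\<close>, with flat sections given by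
  \<open>d\<Phi> = \<Omega>\<Phi>\<close>, is an \<open>End(E)\<close>-valued holomorphic 1-form: \<open>\<Omega> x v\<close> is the endomorphism of \<open>E\<close> obtained
  by evaluating the form at the point \<open>x\<close> on the tangent vector \<open>v\<close>. Holomorphic means Frechet
  differentiable with complex linear derivative.
\<close>

definition holomorphic_connection ::
  "(complex \<Rightarrow> 'v::real_normed_vector \<Rightarrow> 'v) \<Rightarrow> (complex \<Rightarrow> 'e::real_normed_vector \<Rightarrow> 'e) \<Rightarrow> 'v set \<Rightarrow>
    ('v \<Rightarrow> 'v \<Rightarrow> 'e \<Rightarrow> 'e) \<Rightarrow> bool" where
  "holomorphic_connection scaleV scaleE M \<Omega> \<longleftrightarrow> open M \<and>
     (\<forall>x\<in>M. (\<forall>v. Vector_Spaces.linear scaleE scaleE (\<Omega> x v)) \<and>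
       (\<forall>e. Vector_Spaces.linear scaleV scaleE (\<lambda>v. \<Omega> x v e)) \<and>
       (\<forall>v e. \<exists>D. Vector_Spaces.linear scaleV scaleE D \<and> ((\<lambda>y. \<Omega> y v e) has_derivative D) (at x)))"

definition exterior_derivative ::
  "('v::real_normed_vector \<Rightarrow> 'v \<Rightarrow> 'e \<Rightarrow> 'e::real_normed_vector) \<Rightarrow> 'v \<Rightarrow> 'v \<Rightarrow> 'v \<Rightarrow> 'e \<Rightarrow> 'e" where
  "exterior_derivative \<Omega> x u v e =
     frechet_derivative (\<lambda>y. \<Omega> y v e) (at x) u - frechet_derivative (\<lambda>y. \<Omega> y u e) (at x) v"

definition wedge ::
  "('v \<Rightarrow> 'v \<Rightarrow> 'e \<Rightarrow> 'e::ab_group_add) \<Rightarrow> ('v \<Rightarrow> 'v \<Rightarrow> 'e \<Rightarrow> 'e) \<Rightarrow> 'v \<Rightarrow> 'v \<Rightarrow> 'v \<Rightarrow> 'e \<Rightarrow> 'e" where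
  "wedge \<Omega> \<Omega>' x u v e = \<Omega> x u (\<Omega>' x v e) - \<Omega> x v (\<Omega>' x u e)"

definition flat_connection ::
  "(complex \<Rightarrow> 'v::real_normed_vector \<Rightarrow> 'v) \<Rightarrow> (complex \<Rightarrow> 'e::real_normed_vector \<Rightarrow> 'e) \<Rightarrow> 'v set \<Rightarrow>
    ('v \<Rightarrow> 'v \<Rightarrow> 'e \<Rightarrow> 'e) \<Rightarrow> bool" where
  "flat_connection scaleV scaleE M \<Omega> \<longleftrightarrow> holomorphic_connection scaleV scaleE M \<Omega> \<and>
     (\<forall>x\<in>M. \<forall>u v e. exterior_derivative \<Omega> x u v e - wedge \<Omega> \<Omega> x u v e = 0)"

text \<open>
  The horizontal space at \<open>(e, x)\<close>, that is, the tangent space at \<open>(e, x)\<close> to the graph of a local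
  section \<open>\<Phi>\<close> with \<open>\<Phi> x = e\<close> and \<open>d\<Phi> = \<Omega>\<Phi>\<close> at \<open>x\<close>.
\<close>

definition horizontal_space :: "('v \<Rightarrow> 'v \<Rightarrow> 'e \<Rightarrow> 'e) \<Rightarrow> 'e \<times> 'v \<Rightarrow> ('e \<times> 'v) set" where
  "horizontal_space \<Omega> p = {(\<Omega> (snd p) v (fst p), v) |v. True}"

text \<open>
  \<open>w\<close> acts on the total space by \<open>(e, x) \<mapsto> (r w e, w x)\<close>. This map is linear, hence its own
  differential, and the connection is invariant iff it maps horizontal spaces onto horizontal
  spaces. For \<open>\<Omega> = \<Sum>\<^sub>i X\<^sub>i \<omega>\<^sub>i\<close> this amounts to \<open>X\<^bsub>w(i)\<^esub> = r(w) X\<^sub>i r(w)\<^sup>-\<^sup>1\<close>.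
\<close>

definition invariant_connection ::
  "('v \<Rightarrow> 'v) set \<Rightarrow> (('v \<Rightarrow> 'v) \<Rightarrow> 'e \<Rightarrow> 'e) \<Rightarrow> 'v set \<Rightarrow> ('v \<Rightarrow> 'v \<Rightarrow> 'e \<Rightarrow> 'e) \<Rightarrow> bool" where
  "invariant_connection G r M \<Omega> \<longleftrightarrow>
     (\<forall>w\<in>G. map_prod (r w) w ` (UNIV \<times> M) = UNIV \<times> M \<and>
       (\<forall>p\<in>UNIV \<times> M. map_prod (r w) w ` horizontal_space \<Omega> p =
          horizontal_space \<Omega> (map_prod (r w) w p)))"

text \<open>\<open>d log f\<close>, evaluated at \<open>x\<close> on \<open>v\<close>.\<close>

definition dlog :: "('v::real_normed_vector \<Rightarrow> complex) \<Rightarrow> 'v \<Rightarrow> 'v \<Rightarrow> complex" where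
  "dlog f x v = frechet_derivative f (at x) v / f x"

definition defining_form :: "(complex \<Rightarrow> 'v::ab_group_add \<Rightarrow> 'v) \<Rightarrow> 'v set \<Rightarrow> ('v \<Rightarrow> complex) \<Rightarrow> bool" where
  "defining_form scaleV H f \<longleftrightarrow> Vector_Spaces.linear scaleV (*) f \<and> f \<noteq> (\<lambda>_. 0) \<and> {x. f x = 0} = H"

definition brauer_connection ::
  "(complex \<Rightarrow> 'v::real_normed_vector \<Rightarrow> 'v) \<Rightarrow> ('v \<Rightarrow> 'v) set \<Rightarrow> 'p set \<Rightarrow> ('p \<Rightarrow> 'v set) \<Rightarrow>
    (('v \<Rightarrow> 'v) \<Rightarrow> complex) \<Rightarrow> ('p \<Rightarrow> complex) \<Rightarrow> (complex \<Rightarrow> 'e::real_normed_vector \<Rightarrow> 'e) \<Rightarrow>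
    ((('v \<Rightarrow> 'v, 'p) letter list \<Rightarrow> complex) set \<Rightarrow> 'e \<Rightarrow> 'e) \<Rightarrow> ('p \<Rightarrow> 'v \<Rightarrow> complex) \<Rightarrow> complex \<Rightarrow>
    'v \<Rightarrow> 'v \<Rightarrow> 'e \<Rightarrow> 'e" where
  "brauer_connection scaleV G P H \<mu> m scaleE \<rho> f \<kappa> x v e =
     scaleE \<kappa> (\<Sum>i\<in>P. scaleE (dlog (f i) x v)
       ((\<Sum>s | s \<in> reflections scaleV G \<and> fixed_space s = H i.
           scaleE (\<mu> s) (\<rho> (brauer_class scaleV G P H \<mu> m (word_elem [Grp s])) e)) -
        \<rho> (brauer_class scaleV G P H \<mu> m (word_elem [Hyp i])) e))"

end

(*
  Write X_i for the coefficient of omega_i (without kappa). The forms omega_i are closed, so flatness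
  means that the sum of X_i X_j (omega_i wedge omega_j) vanishes. Group the pairs i, j by the
  intersection K of H_i and H_j. Within such a pencil the Arnold relation
  omega_i wedge omega_j = omega_i wedge omega_k + omega_k wedge omega_j (k fixed) reduces the claim
  to Kohno's condition: X_i commutes with the sum S of all X_j with H_j containing K.
  A reflection whose hyperplane contains K permutes these X_j by conjugation, so it commutes with S.
  For e_i, the reflections s of the pencil with s(H_i) = H_i commute with e_i; each other one sends
  H_i to some H_j, and relations (5) and (6) match its contribution to the commutator of e_i with
  the reflection part of S with the commutators of e_i and e_j.
*)
theory Submission
  imports Defs
begin

section \<open>Linear forms on finite dimensional spaces\<close>

text \<open>Commutation with \<open>e i\<close> is a double count. Let N be the reflections of the
  pencil that move \<open>H i\<close>. By relation (3), an s with s(H_k) = H_i satisfies e_i s = s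
  e_k. Sorting N by the preimage of H_i therefore turns the sum of \<mu>(s) e_i s into the products
  e_i e_k of relation (5); sorting the same N by the image of H_i turns the sum of \<mu>(s) s e_i
  into the products e_k e_i. Relation (6) is the case of an empty class, and relation (4) fits
  because N is empty when the pencil has only two members. The sorting is exact only if every
  reflection taking H_i to H_k, or back, has its own hyperplane in the pencil. This, and the fact
  that any two members of a pencil have the same intersection, come from linear dependence of the
  defining forms. The norm on V is arbitrary, so continuity of linear forms has to be proved before
  anything can be differentiated.\<close>

context fin_dim_complex_space
begin

text \<open>\<open>complex\<close> is a Euclidean space, so a real-linear map out of it is bounded
  whatever the norm on the target; \<open>scale_of_real\<close> supplies real linearity.\<close>

lemma bounded_linear_scale_left: "bounded_linear (\<lambda>c. scaleV c x)"
  by (rule linear_conv_bounded_linear[THEN iffD1])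
    (auto intro!: linearI simp: scale_left_distrib scaleR_conv_of_real scale_of_real simp flip: scale_scale)

text \<open>On the unit sphere of the coordinate norm the given norm is continuous and nonzero,
  hence bounded below by compactness; homogeneity extends the bound to all vectors.\<close>

lemma representation_norm_bound:
  obtains C where "\<And>x. (\<Sum>b\<in>B. cmod (representation B x b)) \<le> C * norm x"
proof -
  let ?S = "\<lambda>c. \<Sum>b\<in>B. cmod (c b)"
  \<comment> \<open>Coefficient families are functions on the whole type, so coordinates off
    \<open>B\<close> are pinned to 0; this makes the sphere a closed subset of a product of compact
    sets.\<close>
  define K :: "('a \<Rightarrow> complex) set"
    where "K = Pi\<^sub>E UNIV (\<lambda>b. if b \<in> B then cball 0 1 else {0}) \<inter> {c. ?S c = 1}"
  have "compact (Pi\<^sub>E UNIV (\<lambda>b. if b \<in> B then cball 0 1 else {0 :: complex}))"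
    using compactin_PiE[of "\<lambda>_. euclidean" UNIV "\<lambda>b. if b \<in> B then cball 0 1 else {0 :: complex}"]
    by (simp add: euclidean_product_topology)
  moreover have "closed {c :: 'a \<Rightarrow> complex. ?S c = 1}"
    by (intro closed_Collect_eq continuous_intros continuous_on_product_coordinates)
  ultimately have K: "compact K"
    unfolding K_def by (rule compact_Int_closed)
  define F where "F c = norm (\<Sum>b\<in>B. scaleV (c b) b)" for c
  have contF: "continuous_on K F"
    unfolding F_def
    by (intro continuous_intros bounded_linear.continuous_on[OF bounded_linear_scale_left]
        continuous_on_subset[OF continuous_on_product_coordinates]) auto
  have F0: "F c \<noteq> 0" if "c \<in> K" for c
  proof
    assume "F c = 0"
    then have "(\<Sum>b\<in>B. scaleV (c b) b) = 0" by (simp add: F_def)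
    with independent_Basis finite_Basis have "\<forall>b\<in>B. c b = 0"
      by (auto simp: dependent_finite)
    with that show False by (simp add: K_def)
  qed
  obtain d where d: "d > 0" "\<And>c. c \<in> K \<Longrightarrow> d \<le> F c"
  \<comment> \<open>The sphere is empty exactly in dimension zero, where any positive bound
    serves.\<close>
  proof (cases "K = {}")
    case True
    then show ?thesis using that[of 1] by simp
  next
    case False
    from continuous_attains_inf[OF K False contF] obtain c0 where
      "c0 \<in> K" "\<forall>c\<in>K. F c0 \<le> F c" by blast
    then show ?thesis using that[of "F c0"] F0[of c0] by (auto simp: F_def)
  qed
  have "?S (representation B x) \<le> (1 / d) * norm x" for x
  proof (cases "?S (representation B x) = 0")
    case True
    then show ?thesis using d by simp
  next
    case False
    define s where "s = ?S (representation B x)"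
    have s: "s > 0"
      using False unfolding s_def by (metis norm_ge_zero order_le_less sum_nonneg)
    define c where "c b = representation B x b / of_real s" for b
    have "cmod (representation B x b) \<le> s" if "b \<in> B" for b
      unfolding s_def using that finite_Basis
      by (intro member_le_sum[of b B "\<lambda>b. cmod (representation B x b)"]) auto
    moreover have "representation B x b = 0" if "b \<notin> B" for b
      using that representation_ne_zero by blast
    moreover have "?S c = s / s"
      using s by (simp add: c_def norm_divide s_def[symmetric] flip: sum_divide_distrib)
    ultimately have "c \<in> K"
      using s by (auto simp: K_def c_def norm_divide)
    then have "d \<le> F c" by (rule d)
    also have "(\<Sum>b\<in>B. scaleV (c b) b) = scaleV (of_real (inverse s)) (\<Sum>b\<in>B. scaleV (representation B x b) b)"
      by (simp add: c_def scale_sum_right divide_inverse mult.commute)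
    then have "F c = norm x / s"
      using s sum_representation_eq[OF independent_Basis _ finite_Basis order_refl, of x]
      by (simp add: F_def span_Basis scale_of_real divide_inverse mult.commute del: of_real_inverse)
    finally show ?thesis using s d by (simp add: s_def field_simps)
  qed
  then show ?thesis by (rule that)
qed

text \<open>Differentiating the defining forms requires \<open>bounded_linear\<close>. The values on
  the basis bound f by the coordinates, and the norm bounds the coordinates.\<close>

lemma bounded_linear_form:
  assumes "Vector_Spaces.linear scaleV (*) f"
  shows "bounded_linear f"
proof -
  interpret f: Vector_Spaces.linear scaleV "(*)" f by fact
  obtain C where C: "\<And>x. (\<Sum>b\<in>B. cmod (representation B x b)) \<le> C * norm x"
    using representation_norm_bound by blast
  show ?thesis
  proof (rule bounded_linear_intro)
    show "f (x + y) = f x + f y" for x y by (rule f.add)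
    show "f (r *\<^sub>R x) = r *\<^sub>R f x" for r x
      by (simp add: f.scale scaleR_conv_of_real flip: scale_of_real)
    show "norm (f x) \<le> norm x * (C * (\<Sum>b\<in>B. cmod (f b)))" for x
    proof -
      have "f x = f (\<Sum>b\<in>B. scaleV (representation B x b) b)"
        using sum_representation_eq[OF independent_Basis _ finite_Basis order_refl, of x]
        by (simp add: span_Basis)
      also have "\<dots> = (\<Sum>b\<in>B. representation B x b * f b)"
        by (simp add: f.sum f.scale)
      also have "norm \<dots> \<le> (\<Sum>b\<in>B. cmod (representation B x b) * (\<Sum>b\<in>B. cmod (f b)))"
        by (intro sum_norm_le) (auto simp: norm_mult finite_Basis intro!: mult_left_mono member_le_sum[of _ B "\<lambda>b. cmod (f b)"])
      also have "\<dots> \<le> (C * norm x) * (\<Sum>b\<in>B. cmod (f b))"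
        unfolding sum_distrib_right[symmetric] by (intro mult_right_mono C sum_nonneg) auto
      finally show ?thesis by (simp add: ac_simps)
    qed
  qed
qed

end

section \<open>Linear dependence of forms read off from their kernels\<close>

context vector_space
begin

text \<open>Subtracting a suitable multiple of one vector y with f y \<noteq> 0 moves any x into the
  kernel of f, so g is determined by its value at y.\<close>

lemma linear_form_multiple:
  assumes "Vector_Spaces.linear scale (*) f" "Vector_Spaces.linear scale (*) g"
    and "{x. f x = 0} \<subseteq> {x. g x = 0}"
  obtains c where "\<And>x. g x = c * f x"
proof -
  interpret f: Vector_Spaces.linear scale "(*)" f by fact
  interpret g: Vector_Spaces.linear scale "(*)" g by fact
  show ?thesis
  proof (cases "\<exists>y. f y \<noteq> 0")
    case True
    then obtain y where y: "f y \<noteq> 0" by blast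
    have "g x = (g y / f y) * f x" for x
    proof -
      have "f (x - scale (f x / f y) y) = 0" using y by (simp add: f.diff f.scale)
      then have "g (x - scale (f x / f y) y) = 0" using assms(3) by blast
      then show ?thesis by (simp add: g.diff g.scale)
    qed
    then show ?thesis by (rule that)
  next
    case False
    then show ?thesis using assms(3) by (intro that[of 0]) auto
  qed
qed

text \<open>The vectors y and z, each in exactly one of the two kernels, act as a dual pair for f
  and g: removing the two components of x leaves a vector in both kernels, where h vanishes.\<close>

lemma linear_form_combination:
  assumes "Vector_Spaces.linear scale (*) f" "Vector_Spaces.linear scale (*) g"
    and "Vector_Spaces.linear scale (*) h"
    and "\<not> {x. f x = 0} \<subseteq> {x. g x = 0}" "\<not> {x. g x = 0} \<subseteq> {x. f x = 0}"
    and "{x. f x = 0} \<inter> {x. g x = 0} \<subseteq> {x. h x = 0}"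
  obtains a b where "\<And>x. h x = a * f x + b * g x"
proof -
  interpret f: Vector_Spaces.linear scale "(*)" f by fact
  interpret g: Vector_Spaces.linear scale "(*)" g by fact
  interpret h: Vector_Spaces.linear scale "(*)" h by fact
  obtain y z where yz: "f y = 0" "g y \<noteq> 0" "g z = 0" "f z \<noteq> 0" using assms(4,5) by blast
  have "h x = (h z / f z) * f x + (h y / g y) * g x" for x
  proof -
    let ?x = "x - scale (f x / f z) z - scale (g x / g y) y"
    have "f ?x = 0" "g ?x = 0" using yz by (simp_all add: f.diff f.scale g.diff g.scale)
    then have "h ?x = 0" using assms(6) by blast
    then show ?thesis by (simp add: h.diff h.add h.scale algebra_simps)
  qed
  then show ?thesis by (rule that)
qed

end

section \<open>The hyperplane arrangement of a reflection group\<close>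

locale reflection_arrangement = fin_dim_complex_space scaleV B
  for scaleV :: "complex \<Rightarrow> 'v::real_normed_vector \<Rightarrow> 'v" and B :: "'v set" +
  fixes G :: "('v \<Rightarrow> 'v) set" and P :: "'p set" and H :: "'p \<Rightarrow> 'v set"
    and f :: "'p \<Rightarrow> 'v \<Rightarrow> complex"
  assumes pseudo_reflection_group: "pseudo_reflection_group scaleV G"
    and indexes_hyperplanes: "indexes_hyperplanes scaleV G P H"
    and defining_form: "\<And>i. i \<in> P \<Longrightarrow> defining_form scaleV (H i) (f i)"
begin

abbreviation "R \<equiv> reflections scaleV G"
abbreviation "M \<equiv> complement P H"

lemma finite_G: "finite G"
  using pseudo_reflection_group by (simp add: pseudo_reflection_group_def)

lemma R_in_G: "s \<in> R \<Longrightarrow> s \<in> G"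
  by (simp add: reflections_def)

lemma finite_R: "finite R"
  using finite_G by (rule finite_subset[rotated]) (auto simp: R_in_G)

lemma inj_H: "inj_on H P"
  using indexes_hyperplanes by (simp add: indexes_hyperplanes_def bij_betw_def)

lemma H_image: "H ` P = fixed_space ` R"
  using indexes_hyperplanes by (simp add: indexes_hyperplanes_def bij_betw_def)

lemma finite_P: "finite P"
  using inj_H H_image finite_R by (metis finite_image_iff finite_imageI)

lemma H_eq_iff: "i \<in> P \<Longrightarrow> j \<in> P \<Longrightarrow> H i = H j \<longleftrightarrow> i = j"
  using inj_H by (auto dest: inj_onD)

lemma linear_f: "i \<in> P \<Longrightarrow> Vector_Spaces.linear scaleV (*) (f i)"
  using defining_form by (simp add: defining_form_def)

lemma H_kernel: "i \<in> P \<Longrightarrow> H i = {x. f i x = 0}"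
  using defining_form by (auto simp: defining_form_def)

lemma f_nonzero: "i \<in> P \<Longrightarrow> f i \<noteq> (\<lambda>_. 0)"
  using defining_form by (simp add: defining_form_def)

lemma f_complement: "i \<in> P \<Longrightarrow> x \<in> M \<Longrightarrow> f i x \<noteq> 0"
  by (auto simp: complement_def H_kernel)

text \<open>Inclusion of kernels makes \<open>f j\<close> a multiple of \<open>f i\<close>; the
  factor is nonzero because \<open>f j\<close> is, so the kernels agree.\<close>

lemma H_subset_iff:
  assumes "i \<in> P" "j \<in> P"
  shows "H i \<subseteq> H j \<longleftrightarrow> i = j"
proof
  assume "H i \<subseteq> H j"
  then obtain c where c: "\<And>x. f j x = c * f i x"
    using linear_form_multiple[OF linear_f linear_f, OF assms] assms by (auto simp: H_kernel)
  then have "c \<noteq> 0" using f_nonzero[OF assms(2)] by auto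
  then have "H i = H j" using c assms by (auto simp: H_kernel)
  then show "i = j" using assms by (simp add: H_eq_iff)
qed auto

section \<open>Pencils of hyperplanes\<close>

lemma pencil_combination:
  assumes "i \<in> P" "j \<in> P" "k \<in> P" "i \<noteq> j" "H i \<inter> H j \<subseteq> H k"
  obtains a b where "\<And>x. f k x = a * f i x + b * f j x"
proof -
  have "\<not> H i \<subseteq> H j" "\<not> H j \<subseteq> H i" using assms by (auto simp: H_subset_iff)
  then show ?thesis
    using linear_form_combination[OF linear_f linear_f linear_f, of i j k] assms that
    by (auto simp: H_kernel)
qed

text \<open>In \<open>f k = a f i + b f j\<close> the coefficient b is nonzero, since otherwise
  \<open>H i \<subseteq> H k\<close>; so where \<open>f i\<close> vanishes, \<open>f j\<close> and
  \<open>f k\<close> vanish together.\<close>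

lemma pencil_eq:
  assumes "i \<in> P" "j \<in> P" "k \<in> P" "i \<noteq> j" "i \<noteq> k" "H i \<inter> H j \<subseteq> H k"
  shows "H i \<inter> H k = H i \<inter> H j"
proof -
  obtain a b where ab: "\<And>x. f k x = a * f i x + b * f j x"
    using pencil_combination assms by metis
  have "b \<noteq> 0"
  proof
    assume "b = 0"
    then have "H i \<subseteq> H k" using ab assms by (auto simp: H_kernel)
    then show False using assms by (simp add: H_subset_iff)
  qed
  then show ?thesis using ab assms by (auto simp: H_kernel)
qed

text \<open>The pair i, j is exchanged for k, l one index at a time by \<open>pencil_eq\<close>.
  Consequently grouping pairs of distinct indices by their intersection yields full pencils.\<close>

lemma pencil_Int:
  assumes "i \<in> P" "j \<in> P" "k \<in> P" "l \<in> P" "i \<noteq> j" "k \<noteq> l"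
    and "H i \<inter> H j \<subseteq> H k" "H i \<inter> H j \<subseteq> H l"
  shows "H k \<inter> H l = H i \<inter> H j"
proof (cases "k = i")
  case True
  then show ?thesis using pencil_eq[of i j l] assms by auto
next
  case False
  then have ik: "H i \<inter> H k = H i \<inter> H j" using pencil_eq[of i j k] assms by auto
  then have "H k \<inter> H i \<subseteq> H l" using assms by auto
  then have "H k \<inter> H l = H k \<inter> H i" using pencil_eq[of k i l] False assms by auto
  then show ?thesis using ik by auto
qed

text \<open>The coefficient of \<open>X\<^sub>i X\<^sub>j\<close> in \<open>\<Omega> \<and> \<Omega>\<close>, up to the factor \<open>\<kappa>\<^sup>2\<close>.\<close>

definition log_wedge :: "'v \<Rightarrow> 'v \<Rightarrow> 'v \<Rightarrow> 'p \<Rightarrow> 'p \<Rightarrow> complex" where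
  "log_wedge x u v i j = (f i u / f i x) * (f j v / f j x) - (f i v / f i x) * (f j u / f j x)"

lemma log_wedge_same: "log_wedge x u v i i = 0"
  by (simp add: log_wedge_def)

lemma log_wedge_swap: "log_wedge x u v i j = - log_wedge x u v j i"
  by (simp add: log_wedge_def mult.commute)

text \<open>The numerators \<open>D\<close> are 2x2 minors of the forms. If
  \<open>f k = a f i + b f j\<close>, then \<open>D i k\<close> is b times \<open>D i j\<close> and
  \<open>D k j\<close> is a times \<open>D i j\<close>; over a common denominator the claim becomes
  that linear relation evaluated at x.\<close>

lemma arnold_relation:
  assumes "x \<in> M" "i \<in> P" "j \<in> P" "k \<in> P" "H i \<inter> H j \<subseteq> H k"
  shows "log_wedge x u v i j = log_wedge x u v i k + log_wedge x u v k j"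
proof (cases "i = j")
  case True
  then show ?thesis using log_wedge_swap[of x u v i k] by (simp add: log_wedge_same)
next
  case False
  obtain a b where ab: "\<And>y. f k y = a * f i y + b * f j y"
    using pencil_combination assms False by metis
  define D where "D k l = f k u * f l v - f k v * f l u" for k l
  have log_wedge: "log_wedge x u v k l = D k l / (f k x * f l x)" for k l
    by (simp add: log_wedge_def D_def diff_divide_distrib)
  have nz: "f i x \<noteq> 0" "f j x \<noteq> 0" "f k x \<noteq> 0"
    using f_complement[OF _ assms(1)] assms(2-4) by simp_all
  have "D i j / (f i x * f j x) = D i j * f k x / (f i x * f j x * f k x)"
    using nz by simp
  also have "\<dots> = D i j * (a * f i x + b * f j x) / (f i x * f j x * f k x)"
    using ab[of x] by simp
  also have "\<dots> = (b * D i j) / (f i x * f k x) + (a * D i j) / (f k x * f j x)"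
    using nz by (simp add: distrib_left add_divide_distrib mult.commute)
  also have "b * D i j = D i k" by (simp add: D_def ab algebra_simps)
  also have "a * D i j = D k j" by (simp add: D_def ab algebra_simps)
  finally show ?thesis by (simp add: log_wedge)
qed

section \<open>Derivatives of the forms and openness of the complement\<close>

lemma bounded_linear_f: "i \<in> P \<Longrightarrow> bounded_linear (f i)"
  by (intro bounded_linear_form linear_f)

lemma dlog_f: "i \<in> P \<Longrightarrow> dlog (f i) x v = f i v / f i x"
  using frechet_derivative_at[OF bounded_linear_imp_has_derivative[OF bounded_linear_f], of i x]
  by (simp add: dlog_def)

lemma open_complement: "open M"
proof -
  have "closed (H i)" if "i \<in> P" for i
    unfolding H_kernel[OF that]
    by (intro closed_Collect_eq continuous_intros bounded_linear.continuous_on[OF bounded_linear_f[OF that]])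
  then show ?thesis
    unfolding complement_def using finite_P by (intro open_Diff closed_UN) auto
qed

section \<open>The action of G on hyperplanes and reflections\<close>

lemma subgroup_G: "subgroup G (GL scaleV)"
  using pseudo_reflection_group by (simp add: pseudo_reflection_group_def)

lemma G_linear: "w \<in> G \<Longrightarrow> Vector_Spaces.linear scaleV scaleV w"
  and G_bij: "w \<in> G \<Longrightarrow> bij w"
  using subgroup.subset[OF subgroup_G] by (auto simp: GL_def)

lemma G_comp: "w \<in> G \<Longrightarrow> w' \<in> G \<Longrightarrow> w \<circ> w' \<in> G"
  using subgroup.m_closed[OF subgroup_G] by (simp add: GL_def)

text \<open>A subgroup is closed under \<open>m_inv\<close>, which is a definite description over
  the carrier of \<open>GL\<close>. The functional inverse meets that description once it is known
  to be linear.\<close>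

lemma G_inv:
  assumes "w \<in> G"
  shows "inv_into UNIV w \<in> G"
proof -
  let ?w = "inv_into UNIV w"
  have inv: "?w \<circ> w = id" "w \<circ> ?w = id" "bij ?w"
    using G_bij[OF assms] by (auto simp: bij_is_inj surj_iff[symmetric] bij_is_surj bij_imp_bij_inv)
  interpret w: Vector_Spaces.linear scaleV scaleV w using assms by (rule G_linear)
  have w: "?w (w x) = x" "w (?w x) = x" for x using inv by (auto simp: fun_eq_iff)
  have "Vector_Spaces.linear scaleV scaleV ?w"
  proof (unfold_locales)
    show "?w (x + y) = ?w x + ?w y" for x y
      using w(1)[of "?w x + ?w y"] by (simp add: w.add w(2))
    show "?w (scaleV c x) = scaleV c (?w x)" for c x
      using w(1)[of "scaleV c (?w x)"] by (simp add: w.scale w(2))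
  qed
  then have carrier: "?w \<in> carrier (GL scaleV)" using inv(3) by (simp add: GL_def)
  have unique: "y = ?w" if "y \<circ> w = id" for y
    using that w(2) by (metis comp_apply ext id_apply)
  have "m_inv (GL scaleV) w = ?w"
    unfolding m_inv_def
  proof (rule the_equality)
    show "?w \<in> carrier (GL scaleV) \<and> w \<otimes>\<^bsub>GL scaleV\<^esub> ?w = \<one>\<^bsub>GL scaleV\<^esub>
        \<and> ?w \<otimes>\<^bsub>GL scaleV\<^esub> w = \<one>\<^bsub>GL scaleV\<^esub>"
      using carrier inv(1,2) by (simp add: GL_def)
  qed (auto simp: GL_def intro: unique)
  then show ?thesis using subgroup.m_inv_closed[OF subgroup_G assms] by simp
qed

lemma inv_G:
  assumes "w \<in> G"
  shows "inv_into UNIV w (w x) = x" "w (inv_into UNIV w x) = x"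
  using G_bij[OF assms] by (auto simp: bij_is_inj bij_is_surj surj_f_inv_f)

lemma fixed_space_conj:
  assumes "w \<in> G"
  shows "fixed_space (w \<circ> s \<circ> inv_into UNIV w) = w ` fixed_space s"
proof (rule Set.set_eqI)
  fix x
  define y where "y = inv_into UNIV w x"
  have x: "x = w y" by (simp add: y_def inv_G[OF assms])
  have "inj w" by (rule bij_is_inj[OF G_bij[OF assms]])
  then have "w (s y) = w y \<longleftrightarrow> s y = y" "w y \<in> w ` fixed_space s \<longleftrightarrow> y \<in> fixed_space s"
    by (simp_all only: inj_eq inj_image_mem_iff)
  then show "x \<in> fixed_space (w \<circ> s \<circ> inv_into UNIV w) \<longleftrightarrow> x \<in> w ` fixed_space s"
    by (simp add: x fixed_space_def inv_G[OF assms])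
qed

lemma reflection_conj:
  assumes "w \<in> G" "s \<in> R"
  shows "w \<circ> s \<circ> inv_into UNIV w \<in> R"
proof -
  let ?t = "w \<circ> s \<circ> inv_into UNIV w"
  interpret w: Vector_Spaces.linear scaleV scaleV w using assms(1) by (rule G_linear)
  have t: "?t \<in> G" using assms by (simp add: G_comp G_inv R_in_G)
  have s: "pseudo_reflection scaleV s" using assms(2) by (simp add: reflections_def)
  have pow: "?t ^^ n = w \<circ> s ^^ n \<circ> inv_into UNIV w" for n
    by (induction n) (auto simp: fun_eq_iff inv_G[OF assms(1)])
  obtain n where "n > 0" "s ^^ n = id" using s by (auto simp: pseudo_reflection_def)
  then have "\<exists>n>0. ?t ^^ n = id"
    by (intro exI[of _ n]) (auto simp: pow fun_eq_iff inv_G[OF assms(1)])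
  moreover have "?t \<noteq> id"
  proof
    assume "?t = id"
    then have "w (s x) = w x" for x using inv_G(1)[OF assms(1), of x] by (metis comp_apply id_apply)
    then have "s = id" using G_bij[OF assms(1)] by (metis bij_is_inj eq_id_iff injD)
    then show False using s by (simp add: pseudo_reflection_def)
  qed
  moreover obtain K where K: "hyperplane scaleV K" "\<forall>x\<in>K. s x = x"
    using s by (auto simp: pseudo_reflection_def)
  have "hyperplane scaleV (w ` K)"
  proof -
    interpret fw: finite_dimensional_vector_space_pair_1 scaleV B scaleV ..
    have "dim (w ` K) = dim K"
      using fw.dim_image_eq[OF G_linear[OF assms(1)], of K] G_bij[OF assms(1)]
      by (metis bij_is_inj inj_on_subset subset_UNIV)
    then show ?thesis using K(1) by (simp add: hyperplane_def w.subspace_image)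
  qed
  moreover have "\<forall>x\<in>w ` K. ?t x = x" using K(2) by (auto simp: inv_G[OF assms(1)])
  moreover have "?t \<in> carrier (GL scaleV)" using t subgroup.subset[OF subgroup_G] by blast
  ultimately show ?thesis using t by (auto simp: reflections_def pseudo_reflection_def)
qed

text \<open>This turns the action on indices into a function, so that sums over \<open>P\<close> can
  be reindexed by it. \<open>inv_into\<close> returns a genuine index because w(H i) is the fixed
  space of a conjugate reflection.\<close>

definition act :: "('v \<Rightarrow> 'v) \<Rightarrow> 'p \<Rightarrow> 'p" where
  "act w i = inv_into P H (w ` H i)"

lemma act:
  assumes "w \<in> G" "i \<in> P"
  shows "act w i \<in> P" "H (act w i) = w ` H i"
proof -
  obtain s where s: "s \<in> R" "H i = fixed_space s" using H_image assms(2) by blast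
  have "w ` H i \<in> H ` P"
    unfolding H_image s(2) fixed_space_conj[OF assms(1), symmetric]
    using reflection_conj[OF assms(1) s(1)] by (rule imageI)
  then show "act w i \<in> P" "H (act w i) = w ` H i"
    unfolding act_def by (simp_all add: inv_into_into f_inv_into_f)
qed

lemma act_eq_iff:
  assumes "w \<in> G" "i \<in> P" "j \<in> P"
  shows "act w i = j \<longleftrightarrow> w ` H i = H j"
  using act[OF assms(1,2)] assms by (metis H_eq_iff)

lemma act_inv:
  assumes "w \<in> G" "i \<in> P"
  shows "act (inv_into UNIV w) (act w i) = i" "act w (act (inv_into UNIV w) i) = i"
  using assms act[OF assms] act[OF G_inv[OF assms(1)] assms(2)]
  by (simp_all add: act_eq_iff G_inv image_image inv_G[OF assms(1)])

lemma bij_act: "w \<in> G \<Longrightarrow> bij_betw (act w) P P"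
  by (rule bij_betw_byWitness[of _ "act (inv_into UNIV w)"])
    (auto simp: act_inv act G_inv)

text \<open>The double inverse is left unevaluated because \<open>reflection_conj\<close> and
  \<open>fixed_space_conj\<close>, applied to the inverse of w, produce it in this form.\<close>

lemma conj_conj:
  assumes "w \<in> G"
  shows "inv_into UNIV w \<circ> (w \<circ> s \<circ> inv_into UNIV w) \<circ> inv_into UNIV (inv_into UNIV w) = s"
    and "w \<circ> (inv_into UNIV w \<circ> s \<circ> inv_into UNIV (inv_into UNIV w)) \<circ> inv_into UNIV w = s"
  by (simp_all add: fun_eq_iff inv_inv_eq[OF G_bij[OF assms]] inv_G[OF assms])

lemma bij_conj:
  assumes "w \<in> G" "i \<in> P"
  shows "bij_betw (\<lambda>s. w \<circ> s \<circ> inv_into UNIV w)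
    {s \<in> R. fixed_space s = H i} {s \<in> R. fixed_space s = H (act w i)}"
  by (rule bij_betw_byWitness[of _ "\<lambda>s. inv_into UNIV w \<circ> s \<circ> inv_into UNIV (inv_into UNIV w)"])
    (use assms in \<open>auto simp: conj_conj reflection_conj fixed_space_conj G_inv act image_image inv_G[OF assms(1)]\<close>)

lemma reflection_hyperplane:
  assumes "s \<in> R"
  obtains k where "k \<in> P" "fixed_space s = H k"
proof -
  have "fixed_space s \<in> H ` P" unfolding H_image using assms by (rule imageI)
  then show ?thesis using that by blast
qed

lemma image_fixed: "K \<subseteq> fixed_space s \<Longrightarrow> s ` K = K"
  unfolding fixed_space_def by (metis (mono_tags, lifting) Set.set_eqI image_cong image_ident mem_Collect_eq subsetD)

lemma act_own_hyperplane:
  assumes "s \<in> R" "i \<in> P" "fixed_space s = H i"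
  shows "act s i = i"
  using image_fixed[of "H i" s] assms(3) by (simp add: act_eq_iff R_in_G assms)

lemma act_pencil:
  assumes "s \<in> R" "K \<subseteq> fixed_space s" "j \<in> P" "K \<subseteq> H j"
  shows "K \<subseteq> H (act s j)"
  using act(2)[OF R_in_G[OF assms(1)] assms(3)] image_fixed[OF assms(2)] assms(4) by blast

lemma bij_act_pencil:
  assumes "s \<in> R" "K \<subseteq> fixed_space s"
  shows "bij_betw (act s) {j \<in> P. K \<subseteq> H j} {j \<in> P. K \<subseteq> H j}"
proof -
  have s: "s \<in> G" using assms(1) by (rule R_in_G)
  \<comment> \<open>The inverse is only known to lie in \<open>G\<close>, so
    \<open>act_pencil\<close> does not apply to it; it maps K onto itself because s does.\<close>
  have "K \<subseteq> H (act (inv_into UNIV s) j)" if "j \<in> P" "K \<subseteq> H j" for j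
  proof -
    have "s ` K = K" by (rule image_fixed[OF assms(2)])
    then have "inv_into UNIV s ` K = K" using s by (metis G_bij bij_is_inj image_inv_f_f)
    then show ?thesis using that act(2)[OF G_inv[OF s] that(1)] by blast
  qed
  then show ?thesis
    using assms s by (intro bij_betw_byWitness[of _ "act (inv_into UNIV s)"])
      (simp_all add: act_inv act(1) G_inv act_pencil image_subset_iff)
qed

text \<open>Let \<open>H k\<close> be the hyperplane of s. Its intersection with \<open>H i\<close>
  is fixed pointwise, so it lies in \<open>H i\<close> and in the image \<open>H j\<close>; by
  \<open>pencil_eq\<close> it equals \<open>H i \<inter> H j\<close>.\<close>

lemma fixed_space_between:
  assumes "s \<in> R" "i \<in> P" "j \<in> P" "i \<noteq> j" "s ` H i = H j"
  shows "H i \<inter> H j \<subseteq> fixed_space s"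
proof -
  obtain k where k: "k \<in> P" "fixed_space s = H k" using assms(1) by (rule reflection_hyperplane)
  have "i \<noteq> k"
    using act_own_hyperplane[OF assms(1)] k assms act_eq_iff[OF R_in_G[OF assms(1)]] by metis
  have "H i \<inter> H k \<subseteq> s ` H i" using image_fixed[of "H i \<inter> H k" s] k by blast
  then have "H i \<inter> H k \<subseteq> H j" using assms(5) by simp
  from pencil_eq[OF assms(2) k(1) assms(3) \<open>i \<noteq> k\<close> assms(4) this]
  show ?thesis using k by auto
qed

end

section \<open>Kohno's commutation relations\<close>

text \<open>
  The operators by which the generators act. The assumption \<open>e_product\<close> covers both relations
  (5) and (6), the sum over the empty set being zero.
\<close>

locale brauer_operators = reflection_arrangement scaleV B G P H f + E: vector_space scaleE
  for scaleV :: "complex \<Rightarrow> 'v::real_normed_vector \<Rightarrow> 'v" and B :: "'v set"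
    and G :: "('v \<Rightarrow> 'v) set" and P :: "'p set" and H :: "'p \<Rightarrow> 'v set"
    and f :: "'p \<Rightarrow> 'v \<Rightarrow> complex"
    and scaleE :: "complex \<Rightarrow> 'e::ab_group_add \<Rightarrow> 'e" +
  fixes \<mu> :: "('v \<Rightarrow> 'v) \<Rightarrow> complex" and g :: "('v \<Rightarrow> 'v) \<Rightarrow> 'e \<Rightarrow> 'e" and e :: "'p \<Rightarrow> 'e \<Rightarrow> 'e"
  assumes \<mu>_conj: "\<And>w s. w \<in> G \<Longrightarrow> s \<in> R \<Longrightarrow> \<mu> (w \<circ> s \<circ> inv_into UNIV w) = \<mu> s"
    and linear_g: "\<And>w. w \<in> G \<Longrightarrow> Vector_Spaces.linear scaleE scaleE (g w)"
    and linear_e: "\<And>i. i \<in> P \<Longrightarrow> Vector_Spaces.linear scaleE scaleE (e i)"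
    and g_comp: "\<And>w w' z. w \<in> G \<Longrightarrow> w' \<in> G \<Longrightarrow> g w (g w' z) = g (w \<circ> w') z"
    and g_id: "\<And>z. g id z = z"
    and g_e: "\<And>w i j z. w \<in> G \<Longrightarrow> i \<in> P \<Longrightarrow> j \<in> P \<Longrightarrow> w ` H j = H i \<Longrightarrow> g w (e j z) = e i (g w z)"
    and e_commute: "\<And>i j z. i \<in> P \<Longrightarrow> j \<in> P \<Longrightarrow> i \<noteq> j \<Longrightarrow> hyperplanes_above P H i j = {i, j} \<Longrightarrow>
      e i (e j z) = e j (e i z)"
    and e_product: "\<And>i j z. i \<in> P \<Longrightarrow> j \<in> P \<Longrightarrow> i \<noteq> j \<Longrightarrow> hyperplanes_above P H i j \<noteq> {i, j} \<Longrightarrow>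
      e i (e j z) = (\<Sum>s\<in>refl_between scaleV G H i j. scaleE (\<mu> s) (g s (e j z)))"
begin

definition X :: "'p \<Rightarrow> 'e \<Rightarrow> 'e" where
  "X i z = (\<Sum>s | s \<in> R \<and> fixed_space s = H i. scaleE (\<mu> s) (g s z)) - e i z"

definition pencil_sum :: "'v set \<Rightarrow> 'e \<Rightarrow> 'e" where
  "pencil_sum K z = (\<Sum>j | j \<in> P \<and> K \<subseteq> H j. X j z)"

lemma g_linear_simps:
  assumes "w \<in> G"
  shows "g w (\<Sum>a\<in>A. h a) = (\<Sum>a\<in>A. g w (h a))"
    and "g w (scaleE c z) = scaleE c (g w z)"
    and "g w (y - z) = g w y - g w z"
    and "g w (y + z) = g w y + g w z"
proof -
  interpret w: Vector_Spaces.linear scaleE scaleE "g w" using assms by (rule linear_g)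
  show "g w (\<Sum>a\<in>A. h a) = (\<Sum>a\<in>A. g w (h a))" "g w (scaleE c z) = scaleE c (g w z)"
    "g w (y - z) = g w y - g w z" "g w (y + z) = g w y + g w z"
    by (rule w.sum w.scale w.diff w.add)+
qed

lemma e_linear_simps:
  assumes "i \<in> P"
  shows "e i (\<Sum>a\<in>A. h a) = (\<Sum>a\<in>A. e i (h a))"
    and "e i (scaleE c z) = scaleE c (e i z)"
    and "e i (y - z) = e i y - e i z"
    and "e i (y + z) = e i y + e i z"
proof -
  interpret w: Vector_Spaces.linear scaleE scaleE "e i" using assms by (rule linear_e)
  show "e i (\<Sum>a\<in>A. h a) = (\<Sum>a\<in>A. e i (h a))" "e i (scaleE c z) = scaleE c (e i z)"
    "e i (y - z) = e i y - e i z" "e i (y + z) = e i y + e i z"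
    by (rule w.sum w.scale w.diff w.add)+
qed

lemma linear_X:
  assumes "i \<in> P"
  shows "Vector_Spaces.linear scaleE scaleE (X i)"
  by (unfold_locales)
    (use assms in \<open>auto simp: X_def g_linear_simps R_in_G e_linear_simps E.scale_right_distrib E.scale_right_diff_distrib
      sum.distrib E.scale_sum_right E.scale_left_commute intro!: sum.cong\<close>)

text \<open>Conjugation by w carries the reflections with hyperplane \<open>H i\<close> bijectively
  to those with hyperplane w(H i), and \<mu> is constant on conjugacy classes; relation (3) handles
  the \<open>e i\<close> term.\<close>

lemma X_equivariant:
  assumes "w \<in> G" "i \<in> P"
  shows "g w (X i z) = X (act w i) (g w z)"
proof -
  let ?c = "\<lambda>s. w \<circ> s \<circ> inv_into UNIV w"
  have "g w (\<Sum>s | s \<in> R \<and> fixed_space s = H i. scaleE (\<mu> s) (g s z)) =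
      (\<Sum>s | s \<in> R \<and> fixed_space s = H i. scaleE (\<mu> (?c s)) (g (?c s) (g w z)))"
    unfolding g_linear_simps[OF assms(1)]
  proof (intro sum.cong refl)
    fix s assume "s \<in> {s \<in> R. fixed_space s = H i}"
    then have s: "s \<in> R" by simp
    have "?c s \<circ> w = w \<circ> s" by (simp add: fun_eq_iff inv_G[OF assms(1)])
    then have "g w (g s z) = g (?c s) (g w z)"
      using s assms(1) by (simp add: g_comp R_in_G reflection_conj)
    then show "scaleE (\<mu> s) (g w (g s z)) = scaleE (\<mu> (?c s)) (g (?c s) (g w z))"
      by (simp only: \<mu>_conj[OF assms(1) s])
  qed
  also have "\<dots> = (\<Sum>s | s \<in> R \<and> fixed_space s = H (act w i). scaleE (\<mu> s) (g s (g w z)))"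
    by (rule sum.reindex_bij_betw[OF bij_conj[OF assms], of "\<lambda>s. scaleE (\<mu> s) (g s (g w z))"])
  finally show ?thesis
    using g_e[OF assms(1) _ assms(2), of "act w i"] act[OF assms] assms(1) by (simp add: X_def g_linear_simps(3))
qed

lemma g_pencil_sum:
  assumes "s \<in> R" "K \<subseteq> fixed_space s"
  shows "g s (pencil_sum K z) = pencil_sum K (g s z)"
proof -
  have s: "s \<in> G" using assms(1) by (rule R_in_G)
  have "g s (pencil_sum K z) = (\<Sum>j | j \<in> P \<and> K \<subseteq> H j. X (act s j) (g s z))"
    unfolding pencil_sum_def g_linear_simps[OF s] using s by (intro sum.cong) (auto simp: X_equivariant)
  also have "\<dots> = pencil_sum K (g s z)"
    unfolding pencil_sum_def
    by (rule sum.reindex_bij_betw[OF bij_act_pencil[OF assms], of "\<lambda>j. X j (g s z)"])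
  finally show ?thesis .
qed

text \<open>\<open>X\<close> sorts reflections by their own hyperplane, each belonging to exactly
  one index. Flattening this into a single sum lets \<open>e_pencil_sum\<close> sort them anew, by
  what they do to \<open>H i\<close>.\<close>

lemma pencil_sum_eq:
  "pencil_sum K z = (\<Sum>s | s \<in> R \<and> K \<subseteq> fixed_space s. scaleE (\<mu> s) (g s z))
    - (\<Sum>j | j \<in> P \<and> K \<subseteq> H j. e j z)"
proof -
  let ?PK = "{j \<in> P. K \<subseteq> H j}" and ?RK = "{s \<in> R. K \<subseteq> fixed_space s}"
  let ?h = "\<lambda>s. scaleE (\<mu> s) (g s z)"
  have "fixed_space ` ?RK \<subseteq> H ` ?PK"
    by (auto elim: reflection_hyperplane)
  then have "(\<Sum>s\<in>?RK. ?h s) = (\<Sum>K'\<in>H ` ?PK. \<Sum>s\<in>{s \<in> ?RK. fixed_space s = K'}. ?h s)"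
    using finite_R finite_P by (intro sum.group[symmetric]) auto
  also have "\<dots> = (\<Sum>j\<in>?PK. \<Sum>s\<in>{s \<in> ?RK. fixed_space s = H j}. ?h s)"
    by (subst sum.reindex) (auto intro: inj_on_subset[OF inj_H])
  also have "\<dots> = (\<Sum>j\<in>?PK. \<Sum>s | s \<in> R \<and> fixed_space s = H j. ?h s)"
    by (intro sum.cong) auto
  finally show ?thesis by (simp add: pencil_sum_def X_def sum_subtractf)
qed

text \<open>Replacing j by k keeps the intersection, so whether relation (4) or relations (5) and
  (6) govern a pair is decided at once for all pairs of the pencil containing i.\<close>

lemma hyperplanes_above_pencil:
  assumes "i \<in> P" "j \<in> P" "k \<in> P" "i \<noteq> j" "i \<noteq> k" "H i \<inter> H j \<subseteq> H k"
  shows "hyperplanes_above P H i k = hyperplanes_above P H i j"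
    and "hyperplanes_above P H k i = hyperplanes_above P H i j"
  using pencil_eq[OF assms] by (auto simp: hyperplanes_above_def Int_commute)

text \<open>
  The reflections whose hyperplane lies in the pencil and which move \<open>H i\<close> cancel against the
  products \<open>e\<^sub>i e\<^sub>k\<close> and \<open>e\<^sub>k e\<^sub>i\<close>.
\<close>

lemma e_pencil_sum:
  assumes "i \<in> P" "j \<in> P" "i \<noteq> j"
  shows "e i (pencil_sum (H i \<inter> H j) z) = pencil_sum (H i \<inter> H j) (e i z)"
proof -
  let ?K = "H i \<inter> H j"
  let ?R = "{s \<in> R. ?K \<subseteq> fixed_space s}"
  define P' where "P' = {k \<in> P. ?K \<subseteq> H k} - {i}"
  define N where "N = {s \<in> ?R. s ` H i \<noteq> H i}"
  have PK: "{k \<in> P. ?K \<subseteq> H k} = insert i P'" and P': "finite P'" "i \<notin> P'" "P' \<subseteq> P"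
    using assms finite_P by (auto simp: P'_def)
  have N: "finite N" "N \<subseteq> R" "N \<subseteq> ?R" using finite_R by (auto simp: N_def)
  have fixing: "e i (g s z) = g s (e i z)" if "s \<in> ?R - N" for s
    using that assms by (auto simp: N_def g_e R_in_G)
  have split: "sum h ?R = sum h (?R - N) + sum h N" for h :: "_ \<Rightarrow> 'e"
    using finite_R N by (intro sum.subset_diff) auto
  have key: "(\<Sum>s\<in>N. scaleE (\<mu> s) (e i (g s z))) - (\<Sum>s\<in>N. scaleE (\<mu> s) (g s (e i z)))
     = (\<Sum>k\<in>P'. e i (e k z)) - (\<Sum>k\<in>P'. e k (e i z))"
  proof (cases "hyperplanes_above P H i j = {i, j}")
    case True
    then have P'j: "P' = {j}" using assms by (auto simp: P'_def hyperplanes_above_def)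
    \<comment> \<open>The hyperplane of s is \<open>H i\<close> or \<open>H j\<close>. It is not
      \<open>H i\<close>, which s moves, so it is \<open>H j\<close>. Then s maps both
      \<open>H i\<close> and \<open>H j\<close> to \<open>H j\<close>, against injectivity.\<close>
    have "False" if s: "s \<in> N" for s
    proof -
      have sR: "s \<in> R" "s \<in> G" "?K \<subseteq> fixed_space s" using s R_in_G by (auto simp: N_def)
      obtain k where k: "k \<in> P" "fixed_space s = H k" using sR(1) by (rule reflection_hyperplane)
      have ne: "act s i \<noteq> i" using s assms(1) sR by (auto simp: N_def act_eq_iff)
      have "act s i \<in> hyperplanes_above P H i j"
        using act_pencil[OF sR(1,3) assms(1)] act(1)[OF sR(2) assms(1)] by (auto simp: hyperplanes_above_def)
      then have "act s i = j" using ne True by auto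
      moreover have "k \<in> hyperplanes_above P H i j" using k sR by (auto simp: hyperplanes_above_def)
      then have "k = j" using True ne act_own_hyperplane[OF sR(1) k] by auto
      then have "act s j = j" using act_own_hyperplane[OF sR(1) k] by simp
      ultimately show False
        using bij_betw_imp_inj_on[OF bij_act[OF sR(2)]] assms by (metis inj_onD)
    qed
    then have "N = {}" by blast
    then show ?thesis using e_commute[OF assms True] P'j by simp
  next
    case False
    have above: "hyperplanes_above P H i k \<noteq> {i, k}" "hyperplanes_above P H k i \<noteq> {k, i}"
      if "k \<in> P'" for k
    proof -
      have "k \<in> P" "i \<noteq> k" "?K \<subseteq> H k" using that by (auto simp: P'_def)
      note above = hyperplanes_above_pencil[OF assms(1,2) this(1) assms(3) this(2,3)]
      have "j \<in> hyperplanes_above P H i j" using assms by (auto simp: hyperplanes_above_def)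
      then show "hyperplanes_above P H i k \<noteq> {i, k}" "hyperplanes_above P H k i \<noteq> {k, i}"
        using False above assms(3) by auto
    qed
    \<comment> \<open>This is what makes the classes of \<open>N\<close> below the full sets
      \<open>refl_between scaleV G H k i\<close> and \<open>refl_between scaleV G H i k\<close>, and
      not merely parts of them.\<close>
    have between: "s \<in> ?R" if "s \<in> R" "k \<in> P'" "s ` H i = H k \<or> s ` H k = H i" for s k
    proof -
      have k: "k \<in> P" "i \<noteq> k" "?K \<subseteq> H k" using that by (auto simp: P'_def)
      then have "H i \<inter> H k = ?K" using pencil_eq assms by blast
      then show ?thesis
        using fixed_space_between[OF that(1) assms(1) k(1,2)]
          fixed_space_between[OF that(1) k(1) assms(1)] k(2) that by auto
    qed
    have NG: "N \<subseteq> G" using N R_in_G by auto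
    have N1: "{s \<in> N. act s i = k} = refl_between scaleV G H k i" if k: "k \<in> P'" for k
    proof -
      have kP: "k \<in> P" "H k \<noteq> H i" using k P' assms by (auto simp: H_eq_iff)
      have "s \<in> N \<and> act s i = k \<longleftrightarrow> s \<in> R \<and> s ` H i = H k" for s
        using act_eq_iff[OF _ assms(1) kP(1), of s] between[of s k] kP k NG R_in_G[of s]
        unfolding N_def by (simp only: mem_Collect_eq) metis
      then show ?thesis by (simp add: refl_between_def)
    qed
    have inv: "act (inv_into UNIV s) i = k \<longleftrightarrow> act s k = i" if "s \<in> G" "k \<in> P" for s k
      using act_inv[OF that] act_inv[OF that(1) assms(1)] by auto
    have N2: "{s \<in> N. act (inv_into UNIV s) i = k} = refl_between scaleV G H i k" if k: "k \<in> P'" for k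
    proof -
      have kP: "k \<in> P" "k \<noteq> i" using k P' by auto
      have "s \<in> N \<and> act (inv_into UNIV s) i = k \<longleftrightarrow> s \<in> R \<and> s ` H k = H i" for s
      proof
        assume s: "s \<in> N \<and> act (inv_into UNIV s) i = k"
        then have "s \<in> R" "s \<in> G" using N NG by auto
        then show "s \<in> R \<and> s ` H k = H i" using inv s kP assms by (simp add: act_eq_iff)
      next
        assume s: "s \<in> R \<and> s ` H k = H i"
        then have sG: "s \<in> G" by (simp add: R_in_G)
        then have a: "act s k = i" using s kP assms by (simp add: act_eq_iff)
        have "act s i \<noteq> i"
          using a bij_betw_imp_inj_on[OF bij_act[OF sG]] assms(1) kP by (metis inj_onD)
        then have "s ` H i \<noteq> H i" using sG assms(1) by (simp add: act_eq_iff)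
        then show "s \<in> N \<and> act (inv_into UNIV s) i = k"
          using between[of s k] s k inv[OF sG kP(1)] a by (simp add: N_def)
      qed
      then show ?thesis by (auto simp: refl_between_def)
    qed
    have img1: "(\<lambda>s. act s i) ` N \<subseteq> P'"
    proof (intro image_subsetI)
      fix s assume s: "s \<in> N"
      then have sR: "s \<in> R" "s \<in> G" "?K \<subseteq> fixed_space s" using N NG by auto
      have "act s i \<noteq> i" using s sR assms(1) by (simp add: N_def act_eq_iff)
      then show "act s i \<in> P'"
        using act_pencil[OF sR(1,3) assms(1)] act(1)[OF sR(2) assms(1)] by (simp add: P'_def)
    qed
    have img2: "(\<lambda>s. act (inv_into UNIV s) i) ` N \<subseteq> P'"
    proof (intro image_subsetI)
      fix s assume s: "s \<in> N"
      then have sR: "s \<in> R" "s \<in> G" "?K \<subseteq> fixed_space s" using N NG by auto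
      let ?k = "act (inv_into UNIV s) i"
      have k: "?k \<in> P" "act s ?k = i" using sR assms by (auto simp: act G_inv act_inv)
      have "?k \<noteq> i" using s k sR assms by (auto simp: N_def act_eq_iff)
      moreover have "?K \<subseteq> H ?k"
      proof -
        \<comment> \<open>The permutation \<open>act s\<close> of the pencil hits i, and the
          preimage of i is \<open>?k\<close>, which therefore belongs to the pencil.\<close>
        have "i \<in> act s ` {k \<in> P. ?K \<subseteq> H k}"
          using bij_betw_imp_surj_on[OF bij_act_pencil[OF sR(1,3)]] assms(1) by auto
        then obtain k' where "k' \<in> P" "?K \<subseteq> H k'" "act s k' = i" by auto
        then show ?thesis using inv[OF sR(2)] by metis
      qed
      ultimately show "?k \<in> P'" using k by (simp add: P'_def)
    qed
    have "(\<Sum>k\<in>P'. e k (e i z)) = (\<Sum>k\<in>P'. \<Sum>s\<in>{s \<in> N. act s i = k}. scaleE (\<mu> s) (g s (e i z)))"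
      using P' assms above by (intro sum.cong refl) (subst e_product, auto simp: N1)
    also have "\<dots> = (\<Sum>s\<in>N. scaleE (\<mu> s) (g s (e i z)))"
      using N P' img1 by (intro sum.group)
    finally have 1: "(\<Sum>k\<in>P'. e k (e i z)) = (\<Sum>s\<in>N. scaleE (\<mu> s) (g s (e i z)))" .
    have "(\<Sum>k\<in>P'. e i (e k z)) =
        (\<Sum>k\<in>P'. \<Sum>s\<in>{s \<in> N. act (inv_into UNIV s) i = k}. scaleE (\<mu> s) (e i (g s z)))"
    proof (intro sum.cong refl)
      fix k assume k: "k \<in> P'"
      then have kP: "k \<in> P" "k \<noteq> i" using P' by auto
      \<comment> \<open>Relation (3) rewrites the terms of relation (5) so that \<open>e i\<close>
        stands outermost, as in the commutator.\<close>
      have "g s (e k z) = e i (g s z)" if "s \<in> refl_between scaleV G H i k" for s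
        using that kP assms by (auto simp: refl_between_def g_e R_in_G)
      then show "e i (e k z) =
          (\<Sum>s\<in>{s \<in> N. act (inv_into UNIV s) i = k}. scaleE (\<mu> s) (e i (g s z)))"
        unfolding N2[OF k] using e_product[OF assms(1) kP(1) _ above(1)[OF k]] kP by auto
    qed
    also have "\<dots> = (\<Sum>s\<in>N. scaleE (\<mu> s) (e i (g s z)))"
      using N P' img2 by (intro sum.group)
    finally show ?thesis using 1 by simp
  qed
  have "e i (pencil_sum ?K z) = (\<Sum>s\<in>?R. scaleE (\<mu> s) (e i (g s z))) - (e i (e i z) + (\<Sum>k\<in>P'. e i (e k z)))"
    using P' assms by (simp add: pencil_sum_eq e_linear_simps PK)
  moreover have "pencil_sum ?K (e i z) = (\<Sum>s\<in>?R. scaleE (\<mu> s) (g s (e i z))) - (e i (e i z) + (\<Sum>k\<in>P'. e k (e i z)))"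
    using P' assms by (simp add: pencil_sum_eq PK)
  moreover have "(\<Sum>s\<in>?R - N. scaleE (\<mu> s) (e i (g s z))) = (\<Sum>s\<in>?R - N. scaleE (\<mu> s) (g s (e i z)))"
    by (intro sum.cong refl) (simp only: fixing)
  moreover have "(\<Sum>s\<in>N. scaleE (\<mu> s) (e i (g s z))) = (\<Sum>s\<in>N. scaleE (\<mu> s) (g s (e i z)))
      + ((\<Sum>k\<in>P'. e i (e k z)) - (\<Sum>k\<in>P'. e k (e i z)))"
    by (simp flip: key)
  ultimately show ?thesis by (simp only: split) (simp add: algebra_simps)
qed

lemma X_pencil_sum:
  assumes "i \<in> P" "j \<in> P" "i \<noteq> j"
  shows "X i (pencil_sum (H i \<inter> H j) z) = pencil_sum (H i \<inter> H j) (X i z)"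
proof -
  let ?K = "H i \<inter> H j"
  have lin: "Vector_Spaces.linear scaleE scaleE (pencil_sum ?K)"
  proof -
    interpret vector_space_pair scaleE scaleE ..
    show ?thesis unfolding pencil_sum_def using linear_X by (intro linear_compose_sum) auto
  qed
  interpret S: Vector_Spaces.linear scaleE scaleE "pencil_sum ?K" by (rule lin)
  have "g s (pencil_sum ?K z) = pencil_sum ?K (g s z)" if "s \<in> R" "fixed_space s = H i" for s
    using that by (intro g_pencil_sum) auto
  then show ?thesis
    unfolding X_def S.diff S.sum S.scale e_pencil_sum[OF assms] by (simp cong: sum.cong_simp)
qed

text \<open>
  By the Arnold relation every \<open>\<omega>\<^sub>i \<and> \<omega>\<^sub>j\<close> of a pencil equals
  \<open>\<omega>\<^sub>i \<and> \<omega>\<^sub>k - \<omega>\<^sub>j \<and> \<omega>\<^sub>k\<close> for a fixed \<open>k\<close>, so that only commutators with the pencil sum remain.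
\<close>

lemma pencil_wedge:
  assumes "x \<in> M" "i \<in> P" "j \<in> P" "i \<noteq> j"
  defines "Q \<equiv> {k \<in> P. H i \<inter> H j \<subseteq> H k}"
  shows "(\<Sum>k\<in>Q. \<Sum>l\<in>Q. scaleE (log_wedge x u v k l) (X k (X l z))) = 0"
proof -
  let ?K = "H i \<inter> H j"
  let ?c = "log_wedge x u v"
  have Q: "Q \<subseteq> P" "i \<in> Q" "j \<in> Q" using assms by (auto simp: Q_def)
  have arnold: "?c k l = ?c k i + ?c i l" if "k \<in> Q" "l \<in> Q" for k l
  proof (cases "k = l")
    case True
    then show ?thesis using log_wedge_swap[of x u v i l] by (simp add: log_wedge_same)
  next
    case False
    then have "H k \<inter> H l = ?K" using that assms(2-4) by (intro pencil_Int) (auto simp: Q_def)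
    then show ?thesis using that Q assms by (intro arnold_relation) (auto simp: Q_def)
  qed
  have commute: "X k (pencil_sum ?K y) = pencil_sum ?K (X k y)" if k: "k \<in> Q" for k y
  proof (cases "k = i")
    case True
    then show ?thesis using X_pencil_sum assms by simp
  next
    case False
    \<comment> \<open>Every k in the pencil other than i recovers the same K together with i, so
      \<open>X_pencil_sum\<close> for the pair k, i speaks of the same pencil sum.\<close>
    then have "H k \<inter> H i = ?K" using k assms(2-4) by (intro pencil_Int) (auto simp: Q_def)
    then show ?thesis using X_pencil_sum[of k i y] k assms False by (auto simp: Q_def)
  qed
  have X_pencil: "X k (pencil_sum ?K y) = (\<Sum>l\<in>Q. X k (X l y))" if "k \<in> Q" for k y
  proof -
    interpret k: Vector_Spaces.linear scaleE scaleE "X k" using that Q by (intro linear_X) auto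
    show ?thesis by (simp add: pencil_sum_def Q_def k.sum)
  qed
  have "(\<Sum>k\<in>Q. \<Sum>l\<in>Q. scaleE (?c k l) (X k (X l z))) =
      (\<Sum>k\<in>Q. \<Sum>l\<in>Q. scaleE (?c k i) (X k (X l z)) + scaleE (?c i l) (X k (X l z)))"
    by (intro sum.cong refl) (simp add: arnold flip: E.scale_left_distrib)
  \<comment> \<open>One coefficient depends on k alone and the other on l alone, so each inner sum
    is one \<open>X\<close> composed with the pencil sum. Commuting the pencil sum to the left
    leaves \<open>?c k i + ?c i k\<close>, which is zero.\<close>
  also have "\<dots> = (\<Sum>k\<in>Q. scaleE (?c k i) (\<Sum>l\<in>Q. X k (X l z))) +
      (\<Sum>l\<in>Q. scaleE (?c i l) (\<Sum>k\<in>Q. X k (X l z)))"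
    by (simp add: sum.distrib E.scale_sum_right, subst sum.swap, simp)
  also have "\<dots> = (\<Sum>k\<in>Q. scaleE (?c k i) (pencil_sum ?K (X k z)) + scaleE (?c i k) (pencil_sum ?K (X k z)))"
    unfolding sum.distrib
    by (intro arg_cong2[where f = "(+)"] sum.cong refl)
      (simp add: commute flip: X_pencil, simp add: pencil_sum_def Q_def)
  also have "\<dots> = 0"
    by (intro sum.neutral ballI) (simp add: log_wedge_swap[of x u v i] E.scale_minus_left)
  finally show ?thesis .
qed

lemma wedge_vanishes:
  assumes "x \<in> M"
  shows "(\<Sum>i\<in>P. \<Sum>j\<in>P. scaleE (log_wedge x u v i j) (X i (X j z))) = 0"
proof -
  let ?t = "\<lambda>(i, j). scaleE (log_wedge x u v i j) (X i (X j z))"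
  let ?K = "\<lambda>(i, j). H i \<inter> H j"
  let ?D = "{(i, j) \<in> P \<times> P. i \<noteq> j}"
  have D: "finite ?D" by (rule finite_subset[of _ "P \<times> P"]) (use finite_P in auto)
  \<comment> \<open>Diagonal coefficients vanish. Diagonal pairs are dropped before grouping, since
    (i, i) has the intersection \<open>H i\<close>, which is not the base of a pencil; they are
    restored afterwards to apply \<open>pencil_wedge\<close>.\<close>
  have offdiag: "sum ?t (Q \<times> Q) = sum ?t {(i, j) \<in> Q \<times> Q. i \<noteq> j}" if "Q \<subseteq> P" for Q
    using finite_subset[OF that finite_P]
    by (intro sum.mono_neutral_right) (auto simp: log_wedge_same)
  have "(\<Sum>i\<in>P. \<Sum>j\<in>P. scaleE (log_wedge x u v i j) (X i (X j z))) = sum ?t ?D"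
    by (subst offdiag[symmetric]) (simp_all add: sum.cartesian_product)
  also have "\<dots> = (\<Sum>K\<in>?K ` ?D. \<Sum>p\<in>{p \<in> ?D. ?K p = K}. ?t p)"
    using D by (intro sum.group[symmetric]) auto
  also have "\<dots> = 0"
  proof (rule sum.neutral, rule ballI)
    fix K assume "K \<in> ?K ` ?D"
    then obtain p where p: "K = ?K p" "p \<in> ?D" by (rule imageE)
    obtain i j where ij': "p = (i, j)" by (rule prod.exhaust)
    have ij: "i \<in> P" "j \<in> P" "i \<noteq> j" using p(2) by (simp_all add: ij')
    have K: "K = H i \<inter> H j" using p(1) by (simp add: ij')
    define Q where "Q = {k \<in> P. K \<subseteq> H k}"
    \<comment> \<open>By \<open>pencil_Int\<close>, two distinct hyperplanes containing K meet
      exactly in K.\<close>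
    have "{p \<in> ?D. ?K p = K} = {(k, l) \<in> Q \<times> Q. k \<noteq> l}"
    proof (rule Set.set_eqI)
      fix q :: "'p \<times> 'p"
      obtain k l where q: "q = (k, l)" by (rule prod.exhaust)
      have "H k \<inter> H l = K \<longleftrightarrow> K \<subseteq> H k \<and> K \<subseteq> H l" if "k \<in> P" "l \<in> P" "k \<noteq> l"
        using pencil_Int[OF ij(1,2) that(1,2) ij(3) that(3)] unfolding K by blast
      then show "q \<in> {p \<in> ?D. ?K p = K} \<longleftrightarrow> q \<in> {(k, l) \<in> Q \<times> Q. k \<noteq> l}"
        unfolding q Q_def mem_Collect_eq mem_Sigma_iff prod.case by metis
    qed
    then have "(\<Sum>p\<in>{p \<in> ?D. ?K p = K}. ?t p) = sum ?t (Q \<times> Q)"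
      using offdiag[of Q] by (simp add: Q_def)
    also have "\<dots> = 0"
      using pencil_wedge[OF assms ij(1-3), of u v z] K by (simp add: Q_def sum.cartesian_product)
    finally show "(\<Sum>p\<in>{p \<in> ?D. ?K p = K}. ?t p) = 0" .
  qed
  finally show ?thesis .
qed

end

section \<open>The connection\<close>

locale normed_brauer_operators = brauer_operators scaleV B G P H f scaleE \<mu> g e
    + NE: fin_dim_complex_space scaleE BE
  for scaleV :: "complex \<Rightarrow> 'v::real_normed_vector \<Rightarrow> 'v" and B :: "'v set"
    and G :: "('v \<Rightarrow> 'v) set" and P :: "'p set" and H :: "'p \<Rightarrow> 'v set"
    and f :: "'p \<Rightarrow> 'v \<Rightarrow> complex"
    and scaleE :: "complex \<Rightarrow> 'e::real_normed_vector \<Rightarrow> 'e" and \<mu> g e and BE :: "'e set" +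
  fixes \<kappa> :: complex
begin

definition \<Omega> :: "'v \<Rightarrow> 'v \<Rightarrow> 'e \<Rightarrow> 'e" where
  "\<Omega> x v z = scaleE \<kappa> (\<Sum>i\<in>P. scaleE (dlog (f i) x v) (X i z))"

lemma \<Omega>_eq: "\<Omega> x v z = (\<Sum>i\<in>P. scaleE (\<kappa> * f i v / f i x) (X i z))"
  by (simp add: \<Omega>_def E.scale_sum_right dlog_f)

lemma linear_\<Omega>: "Vector_Spaces.linear scaleE scaleE (\<Omega> x v)"
proof -
  interpret EE: vector_space_pair scaleE scaleE ..
  show ?thesis
    unfolding \<Omega>_eq using linear_X
    by (intro EE.linear_compose_sum ballI EE.linear_compose_scale_right)
qed

lemma linear_form_scale:
  assumes "\<And>i. i \<in> P \<Longrightarrow> Vector_Spaces.linear scaleV (*) (h i)"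
  shows "Vector_Spaces.linear scaleV scaleE (\<lambda>v. \<Sum>i\<in>P. scaleE (h i v) (y i))"
proof -
  interpret VE: vector_space_pair scaleV scaleE ..
  have "Vector_Spaces.linear scaleV scaleE (\<lambda>v. scaleE (h i v) (y i))" if "i \<in> P" for i
  proof -
    interpret h: Vector_Spaces.linear scaleV "(*)" "h i" using that by (rule assms)
    show ?thesis by unfold_locales (simp_all add: h.add h.scale E.scale_left_distrib)
  qed
  then show ?thesis by (intro VE.linear_compose_sum) auto
qed

lemma linear_multiple_f:
  assumes "i \<in> P"
  shows "Vector_Spaces.linear scaleV (*) (\<lambda>v. a * f i v)"
proof -
  interpret f: Vector_Spaces.linear scaleV "(*)" "f i" using assms by (rule linear_f)
  show ?thesis by unfold_locales (simp_all add: f.add f.scale distrib_left)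
qed

lemma linear_\<Omega>_tangent: "Vector_Spaces.linear scaleV scaleE (\<lambda>v. \<Omega> x v z)"
  unfolding \<Omega>_eq
  using linear_form_scale[of "\<lambda>i v. (\<kappa> / f i x) * f i v" "\<lambda>i. X i z", OF linear_multiple_f]
  by simp

text \<open>The quotient rule for a constant over \<open>f i\<close>, grouped as a constant times
  \<open>f i h\<close> to fit \<open>linear_multiple_f\<close>.\<close>

definition \<Omega>_deriv :: "'v \<Rightarrow> 'v \<Rightarrow> 'e \<Rightarrow> 'v \<Rightarrow> 'e" where
  "\<Omega>_deriv x v z h = (\<Sum>i\<in>P. scaleE (- (\<kappa> * f i v / (f i x * f i x)) * f i h) (X i z))"

lemma linear_\<Omega>_deriv: "Vector_Spaces.linear scaleV scaleE (\<Omega>_deriv x v z)"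
  unfolding \<Omega>_deriv_def[abs_def] by (intro linear_form_scale linear_multiple_f)

lemma has_derivative_\<Omega>:
  assumes "x \<in> M"
  shows "((\<lambda>y. \<Omega> y v z) has_derivative \<Omega>_deriv x v z) (at x)"
  unfolding \<Omega>_eq \<Omega>_deriv_def[abs_def]
proof (rule has_derivative_sum)
  fix i assume i: "i \<in> P"
  have "((\<lambda>y. \<kappa> * f i v / f i y) has_derivative
      (\<lambda>h. (0 * f i x - \<kappa> * f i v * f i h) / (f i x * f i x))) (at x)"
    by (intro has_derivative_divide' has_derivative_const bounded_linear_imp_has_derivative
        bounded_linear_f f_complement i assms)
  then have "((\<lambda>y. \<kappa> * f i v / f i y) has_derivative
      (\<lambda>h. - (\<kappa> * f i v / (f i x * f i x)) * f i h)) (at x)"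
    by simp
  then show "((\<lambda>y. scaleE (\<kappa> * f i v / f i y) (X i z)) has_derivative
      (\<lambda>h. scaleE (- (\<kappa> * f i v / (f i x * f i x)) * f i h) (X i z))) (at x)"
    by (rule bounded_linear.has_derivative[OF NE.bounded_linear_scale_left])
qed

text \<open>Each summand of \<open>\<Omega>_deriv x v z h\<close> is symmetric in v and h, so
  antisymmetrizing gives zero: logarithmic forms are closed.\<close>

lemma exterior_derivative_\<Omega>:
  assumes "x \<in> M"
  shows "exterior_derivative \<Omega> x u v z = 0"
proof -
  have "frechet_derivative (\<lambda>y. \<Omega> y v z) (at x) = \<Omega>_deriv x v z" for v
    using frechet_derivative_at[OF has_derivative_\<Omega>[OF assms]] by simp
  then show ?thesis
    by (simp add: exterior_derivative_def \<Omega>_deriv_def mult.commute mult.left_commute)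
qed

lemma wedge_\<Omega>:
  assumes "x \<in> M"
  shows "wedge \<Omega> \<Omega> x u v z = 0"
proof -
  have prod: "\<Omega> x u (\<Omega> x v z) =
      (\<Sum>i\<in>P. \<Sum>j\<in>P. scaleE ((\<kappa> * f i u / f i x) * (\<kappa> * f j v / f j x)) (X i (X j z)))" for u v
    unfolding \<Omega>_eq[of x u]
  proof (intro sum.cong refl)
    fix i assume "i \<in> P"
    then interpret X: Vector_Spaces.linear scaleE scaleE "X i" by (rule linear_X)
    show "scaleE (\<kappa> * f i u / f i x) (X i (\<Omega> x v z)) =
        (\<Sum>j\<in>P. scaleE ((\<kappa> * f i u / f i x) * (\<kappa> * f j v / f j x)) (X i (X j z)))"
      by (simp add: \<Omega>_eq X.sum X.scale E.scale_sum_right)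
  qed
  have "wedge \<Omega> \<Omega> x u v z =
      (\<Sum>i\<in>P. \<Sum>j\<in>P. scaleE ((\<kappa> * \<kappa>) * log_wedge x u v i j) (X i (X j z)))"
    unfolding wedge_def prod sum_subtractf[symmetric] E.scale_left_diff_distrib[symmetric]
    by (intro sum.cong refl arg_cong2[where f = scaleE]) (simp add: log_wedge_def algebra_simps)
  also have "\<dots> = scaleE (\<kappa> * \<kappa>) (\<Sum>i\<in>P. \<Sum>j\<in>P. scaleE (log_wedge x u v i j) (X i (X j z)))"
    by (simp add: E.scale_sum_right)
  finally show ?thesis using wedge_vanishes[OF assms] by simp
qed

lemma flat_\<Omega>: "flat_connection scaleV scaleE M \<Omega>"
proof -
  have "\<exists>D. Vector_Spaces.linear scaleV scaleE D \<and> ((\<lambda>y. \<Omega> y v z) has_derivative D) (at x)"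
    if "x \<in> M" for x v z
    using linear_\<Omega>_deriv has_derivative_\<Omega>[OF that] by blast
  then show ?thesis
    unfolding flat_connection_def holomorphic_connection_def
    by (simp add: open_complement linear_\<Omega> linear_\<Omega>_tangent exterior_derivative_\<Omega> wedge_\<Omega>)
qed

lemma complement_image:
  assumes "w \<in> G"
  shows "w ` M = M"
proof -
  have "w ` (\<Union>i\<in>P. H i) = (\<Union>i\<in>P. H (act w i))"
    using act[OF assms] by (simp add: image_UN)
  also have "\<dots> = (\<Union>i\<in>act w ` P. H i)" by simp
  also have "act w ` P = P" using bij_betw_imp_surj_on[OF bij_act[OF assms]] .
  finally show ?thesis
    using G_bij[OF assms] by (simp add: complement_def image_set_diff bij_is_inj bij_is_surj)
qed

text \<open>Both \<open>f i\<close> and the composite of \<open>f (act w i)\<close> with w have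
  kernel \<open>H i\<close>, so they are proportional, and the factor cancels in the logarithmic
  derivative.\<close>

lemma dlog_equivariant:
  assumes "w \<in> G" "i \<in> P" "x \<in> M"
  shows "f (act w i) (w v) / f (act w i) (w x) = f i v / f i x"
proof -
  interpret w: Vector_Spaces.linear scaleV scaleV w using assms(1) by (rule G_linear)
  have act_P: "act w i \<in> P" by (rule act[OF assms(1,2)])
  interpret f: Vector_Spaces.linear scaleV "(*)" "f (act w i)" by (rule linear_f[OF act_P])
  have "Vector_Spaces.linear scaleV (*) (\<lambda>y. f (act w i) (w y))"
    by unfold_locales (simp_all add: w.add w.scale f.add f.scale)
  moreover have "{y. f i y = 0} \<subseteq> {y. f (act w i) (w y) = 0}"
    using act(2)[OF assms(1,2)] H_kernel[OF act_P] H_kernel[OF assms(2)] by blast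
  ultimately obtain c where c: "\<And>y. f (act w i) (w y) = c * f i y"
    using linear_form_multiple[OF linear_f[OF assms(2)]] by metis
  have "w x \<in> M" using complement_image[OF assms(1)] assms(3) by blast
  then have "f (act w i) (w x) \<noteq> 0" by (rule f_complement[OF act_P])
  then show ?thesis by (simp add: c)
qed

lemma \<Omega>_equivariant:
  assumes "w \<in> G" "x \<in> M"
  shows "g w (\<Omega> x v z) = \<Omega> (w x) (w v) (g w z)"
proof -
  have "g w (\<Omega> x v z) =
      (\<Sum>i\<in>P. scaleE (\<kappa> * f (act w i) (w v) / f (act w i) (w x)) (X (act w i) (g w z)))"
    unfolding \<Omega>_eq g_linear_simps[OF assms(1)]
  proof (intro sum.cong refl)
    fix i assume i: "i \<in> P"
    show "scaleE (\<kappa> * f i v / f i x) (g w (X i z)) =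
        scaleE (\<kappa> * f (act w i) (w v) / f (act w i) (w x)) (X (act w i) (g w z))"
      using dlog_equivariant[OF assms(1) i assms(2), of v] X_equivariant[OF assms(1) i, of z]
      by (simp only: times_divide_eq_right[symmetric])
  qed
  also have "\<dots> = \<Omega> (w x) (w v) (g w z)"
    unfolding \<Omega>_eq
    by (rule sum.reindex_bij_betw[OF bij_act[OF assms(1)],
          of "\<lambda>i. scaleE (\<kappa> * f i (w v) / f i (w x)) (X i (g w z))"])
  finally show ?thesis .
qed

lemma invariant_\<Omega>: "invariant_connection G g M \<Omega>"
  unfolding invariant_connection_def
proof (intro ballI conjI)
  fix w assume w: "w \<in> G"
  have "w \<circ> inv_into UNIV w = id" by (simp add: fun_eq_iff inv_G[OF w])
  then have "g w (g (inv_into UNIV w) z) = z" for z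
    using w by (simp add: g_comp G_inv g_id)
  then have "surj (g w)" by (rule surjI)
  then show "map_prod (g w) w ` (UNIV \<times> M) = UNIV \<times> M"
    by (rule map_prod_surj_on[OF _ complement_image[OF w]])
  fix p :: "'e \<times> 'v" assume "p \<in> UNIV \<times> M"
  then obtain z x where p: "p = (z, x)" "x \<in> M" by auto
  \<comment> \<open>Since w is onto, every tangent vector at the image point is some w v, the form
    in which \<open>\<Omega>_equivariant\<close> applies.\<close>
  have "horizontal_space \<Omega> (map_prod (g w) w p) = (\<lambda>v. (\<Omega> (w x) v (g w z), v)) ` range w"
    using G_bij[OF w] by (auto simp: horizontal_space_def p bij_is_surj)
  also have "\<dots> = map_prod (g w) w ` horizontal_space \<Omega> p"
    using \<Omega>_equivariant[OF w p(2)] by (auto simp: horizontal_space_def p image_iff)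
  finally show "map_prod (g w) w ` horizontal_space \<Omega> p = horizontal_space \<Omega> (map_prod (g w) w p)" ..
qed

end

section \<open>Representations as families of operators\<close>

locale brauer_rep =
  fixes scaleV :: "complex \<Rightarrow> 'v::ab_group_add \<Rightarrow> 'v" and G :: "('v \<Rightarrow> 'v) set"
    and P :: "'p set" and H :: "'p \<Rightarrow> 'v set" and \<mu> :: "('v \<Rightarrow> 'v) \<Rightarrow> complex" and m :: "'p \<Rightarrow> complex"
    and scaleE :: "complex \<Rightarrow> 'e::ab_group_add \<Rightarrow> 'e"
    and \<rho> :: "(('v \<Rightarrow> 'v, 'p) letter list \<Rightarrow> complex) set \<Rightarrow> 'e \<Rightarrow> 'e"
  assumes finite_group: "finite G" and subgroup: "subgroup G (GL scaleV)"
    and representation: "brauer_representation scaleV G P H \<mu> m scaleE \<rho>"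
begin

abbreviation "F \<equiv> free_algebra (letters G P)"
abbreviation "I \<equiv> brauer_ideal scaleV G P H \<mu> m"

text \<open>The representation pulled back along the quotient map, so that computations use words
  and their sums instead of cosets.\<close>

definition \<phi> :: "(('v \<Rightarrow> 'v, 'p) letter list \<Rightarrow> complex) \<Rightarrow> 'e \<Rightarrow> 'e" where
  "\<phi> a = \<rho> (brauer_class scaleV G P H \<mu> m a)"

sublocale F: ring F
  by (rule ring_free_algebra)

sublocale I: ideal I F
  unfolding brauer_ideal_def
  by (intro F.genideal_ideal relators_in_carrier finite_group subgroup)

lemma \<phi>_hom: "\<phi> \<in> ring_hom F (End_ring scaleE)"
proof -
  have "\<rho> \<in> ring_hom (F Quot I) (End_ring scaleE)"
    using representation by (simp add: brauer_representation_def brauer_algebra_def)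
  from ring_hom_trans[OF I.rcos_ring_hom this] show ?thesis
    by (simp add: \<phi>_def[abs_def] brauer_class_def comp_def)
qed

lemma \<phi>_linear: "a \<in> carrier F \<Longrightarrow> Vector_Spaces.linear scaleE scaleE (\<phi> a)"
  using ring_hom_closed[OF \<phi>_hom] by (simp add: End_ring_def)

lemma \<phi>_mult: "a \<in> carrier F \<Longrightarrow> b \<in> carrier F \<Longrightarrow> \<phi> (a \<otimes>\<^bsub>F\<^esub> b) z = \<phi> a (\<phi> b z)"
  using ring_hom_mult[OF \<phi>_hom] by (simp add: End_ring_def)

lemma \<phi>_add: "a \<in> carrier F \<Longrightarrow> b \<in> carrier F \<Longrightarrow> \<phi> (\<lambda>u. a u + b u) z = \<phi> a z + \<phi> b z"
  using ring_hom_add[OF \<phi>_hom, of a b] by (simp add: End_ring_def) (simp add: free_algebra_def)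

lemma \<phi>_empty_word: "\<phi> (word_elem []) z = z"
  using ring_hom_one[OF \<phi>_hom] by (simp add: End_ring_def) (simp add: free_algebra_def word_elem_def)

lemma \<phi>_zero: "\<phi> (\<lambda>_. 0) z = 0"
  using \<phi>_add[of "\<lambda>_. 0" "\<lambda>_. 0" z] F.zero_closed by (simp add: free_algebra_def)

lemma add_carrier: "a \<in> carrier F \<Longrightarrow> b \<in> carrier F \<Longrightarrow> (\<lambda>u. a u + b u) \<in> carrier F"
  using F.add.m_closed[of a b] by (simp add: free_algebra_def)

text \<open>\<open>free_algebra\<close> is a ring record without a scalar action. Writing a scalar
  as a constant polynomial reduces linearity over the complex numbers to the clause of
  \<open>brauer_representation\<close> about constants.\<close>

lemma smult_eq: "(\<lambda>u. c * a u) = (\<lambda>u. c * word_elem [] u) \<otimes>\<^bsub>F\<^esub> a" if "a \<in> carrier F"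
proof -
  have "(\<lambda>u. c * word_elem [] u) \<otimes>\<^bsub>F\<^esub> a = (\<lambda>u. c * (\<one>\<^bsub>F\<^esub> \<otimes>\<^bsub>F\<^esub> a) u)"
    by (simp add: free_algebra_def word_elem_def sum_distrib_left mult.assoc)
  then show ?thesis using that by simp
qed

lemma smult_carrier: "a \<in> carrier F \<Longrightarrow> (\<lambda>u. c * a u) \<in> carrier F"
  by (auto simp: free_algebra_def intro: finite_subset[of _ "{u. a u \<noteq> 0}"])

lemma \<phi>_smult:
  assumes "a \<in> carrier F"
  shows "\<phi> (\<lambda>u. c * a u) z = scaleE c (\<phi> a z)"
proof -
  have "\<phi> (\<lambda>u. c * a u) z = \<phi> (\<lambda>u. c * word_elem [] u) (\<phi> a z)"
    unfolding smult_eq[OF assms] by (intro \<phi>_mult assms smult_carrier word_elem_carrier) simp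
  then show ?thesis
    using representation by (simp add: brauer_representation_def \<phi>_def)
qed

lemma sum_carrier:
  "finite S \<Longrightarrow> (\<And>s. s \<in> S \<Longrightarrow> h s \<in> carrier F) \<Longrightarrow> (\<lambda>u. \<Sum>s\<in>S. h s u) \<in> carrier F"
proof (induction S rule: finite_induct)
  case empty
  then show ?case using F.zero_closed by (simp add: free_algebra_def)
next
  case (insert s S)
  then show ?case using add_carrier[of "h s" "\<lambda>u. \<Sum>s\<in>S. h s u"] by simp
qed

lemma \<phi>_sum:
  "finite S \<Longrightarrow> (\<And>s. s \<in> S \<Longrightarrow> h s \<in> carrier F) \<Longrightarrow> \<phi> (\<lambda>u. \<Sum>s\<in>S. h s u) z = (\<Sum>s\<in>S. \<phi> (h s) z)"
proof (induction S rule: finite_induct)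
  case empty
  then show ?case by (simp add: \<phi>_zero)
next
  case (insert s S)
  then show ?case using \<phi>_add[of "h s" "\<lambda>u. \<Sum>s\<in>S. h s u" z] sum_carrier[of S h] by simp
qed

text \<open>The relator lies in the ideal, so its class is that of 0; additivity is then applied to
  a = (a - b) + b.\<close>

lemma \<phi>_relation:
  assumes "brauer_relation scaleV G P H \<mu> m a b" "b \<in> carrier F"
  shows "\<phi> a z = \<phi> b z"
proof -
  let ?d = "\<lambda>u. a u - b u"
  have sub: "{\<lambda>u. a u - b u |a b. brauer_relation scaleV G P H \<mu> m a b} \<subseteq> carrier F"
    by (intro relators_in_carrier finite_group subgroup)
  have "?d \<in> I"
    using F.genideal_self[OF sub] assms(1) unfolding brauer_ideal_def by blast
  moreover from this have "?d \<in> carrier F" by (rule I.a_Hcarr)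
  moreover have "(\<lambda>_. 0) = \<zero>\<^bsub>F\<^esub>" by (simp add: free_algebra_def)
  ultimately have "\<phi> ?d = \<phi> (\<lambda>_. 0)" "?d \<in> carrier F"
    unfolding \<phi>_def brauer_class_def
    by (simp_all add: I.a_rcos_const)
  then show ?thesis using \<phi>_add[of ?d b z] assms(2) \<phi>_zero by simp
qed

lemma letter_carrier [simp]:
  "word_elem [] \<in> carrier F"
  "w \<in> G \<Longrightarrow> word_elem [Grp w] \<in> carrier F"
  "i \<in> P \<Longrightarrow> word_elem [Hyp i] \<in> carrier F"
  "w \<in> G \<Longrightarrow> i \<in> P \<Longrightarrow> word_elem [Grp w, Hyp i] \<in> carrier F"
  "w \<in> G \<Longrightarrow> i \<in> P \<Longrightarrow> word_elem [Hyp i, Grp w] \<in> carrier F"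
  "i \<in> P \<Longrightarrow> j \<in> P \<Longrightarrow> word_elem [Hyp i, Hyp j] \<in> carrier F"
  by (auto intro!: word_elem_carrier simp: letters_def)

lemma \<phi>_word2:
  assumes "word_elem [a] \<in> carrier F" "word_elem [b] \<in> carrier F"
  shows "\<phi> (word_elem [a, b]) z = \<phi> (word_elem [a]) (\<phi> (word_elem [b]) z)"
  using \<phi>_mult[OF assms] by (simp add: word_elem_mult)

lemma comp_in_group: "w \<in> G \<Longrightarrow> w' \<in> G \<Longrightarrow> w \<circ> w' \<in> G"
  using subgroup.m_closed[OF subgroup] by (simp add: GL_def)

lemma \<phi>_group_mult:
  "w \<in> G \<Longrightarrow> w' \<in> G \<Longrightarrow>
    \<phi> (word_elem [Grp w]) (\<phi> (word_elem [Grp w']) z) = \<phi> (word_elem [Grp (w \<circ> w')]) z"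
  using \<phi>_relation[OF brauer_relation.group_mult, of w w' z] by (simp add: \<phi>_word2 comp_in_group)

lemma \<phi>_group_one: "\<phi> (word_elem [Grp id]) z = z"
  using \<phi>_relation[OF brauer_relation.group_one] by (simp add: \<phi>_empty_word)

lemma \<phi>_equivariant:
  "w \<in> G \<Longrightarrow> i \<in> P \<Longrightarrow> j \<in> P \<Longrightarrow> w ` H j = H i \<Longrightarrow>
    \<phi> (word_elem [Grp w]) (\<phi> (word_elem [Hyp j]) z) = \<phi> (word_elem [Hyp i]) (\<phi> (word_elem [Grp w]) z)"
  using \<phi>_relation[OF brauer_relation.equivariant, of w i j z] by (simp add: \<phi>_word2)

lemma \<phi>_commute:
  "i \<in> P \<Longrightarrow> j \<in> P \<Longrightarrow> i \<noteq> j \<Longrightarrow> hyperplanes_above P H i j = {i, j} \<Longrightarrow>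
    \<phi> (word_elem [Hyp i]) (\<phi> (word_elem [Hyp j]) z) = \<phi> (word_elem [Hyp j]) (\<phi> (word_elem [Hyp i]) z)"
  using \<phi>_relation[OF brauer_relation.commute, of i j z] by (simp add: \<phi>_word2)

lemma \<phi>_product:
  assumes "i \<in> P" "j \<in> P" "i \<noteq> j" "hyperplanes_above P H i j \<noteq> {i, j}"
  shows "\<phi> (word_elem [Hyp i]) (\<phi> (word_elem [Hyp j]) z) =
    (\<Sum>s\<in>refl_between scaleV G H i j. scaleE (\<mu> s) (\<phi> (word_elem [Grp s]) (\<phi> (word_elem [Hyp j]) z)))"
proof (cases "refl_between scaleV G H i j = {}")
  case True
  \<comment> \<open>Relation (6) agrees with the empty sum; \<open>sum_carrier\<close> at the empty
    set puts the zero polynomial in the carrier.\<close>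
  then show ?thesis
    using \<phi>_relation[OF brauer_relation.product_zero[OF assms True], of z] assms
      sum_carrier[of "{}"]
    by (simp add: \<phi>_word2 \<phi>_zero)
next
  case False
  have S: "finite (refl_between scaleV G H i j)" "refl_between scaleV G H i j \<subseteq> G"
    using finite_group by (auto simp: refl_between_def reflections_def)
  have c: "(\<lambda>u. \<mu> s * word_elem [Grp s, Hyp j] u) \<in> carrier F" if "s \<in> refl_between scaleV G H i j" for s
    using that S assms by (intro smult_carrier) auto
  have "\<phi> (word_elem [Hyp i, Hyp j]) z =
      \<phi> (\<lambda>u. \<Sum>s\<in>refl_between scaleV G H i j. \<mu> s * word_elem [Grp s, Hyp j] u) z"
    by (intro \<phi>_relation brauer_relation.product_refl assms False sum_carrier S c)
  also have "\<dots> = (\<Sum>s\<in>refl_between scaleV G H i j. \<phi> (\<lambda>u. \<mu> s * word_elem [Grp s, Hyp j] u) z)"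
    using \<phi>_sum[OF S(1) c] by simp
  also have "\<dots> = (\<Sum>s\<in>refl_between scaleV G H i j.
      scaleE (\<mu> s) (\<phi> (word_elem [Grp s]) (\<phi> (word_elem [Hyp j]) z)))"
    using S assms by (intro sum.cong refl) (simp add: \<phi>_smult \<phi>_word2 subset_eq)
  finally show ?thesis using assms by (simp add: \<phi>_word2)
qed

end

section \<open>Flatness and invariance\<close>

theorem proposition5p1:
  fixes scaleV :: "complex \<Rightarrow> 'v::real_normed_vector \<Rightarrow> 'v" and BV :: "'v set"
    and scaleE :: "complex \<Rightarrow> 'e::real_normed_vector \<Rightarrow> 'e" and BE :: "'e set"
    and G :: "('v \<Rightarrow> 'v) set" and P :: "'p set" and H :: "'p \<Rightarrow> 'v set"
    and f :: "'p \<Rightarrow> 'v \<Rightarrow> complex"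
    and \<mu> :: "('v \<Rightarrow> 'v) \<Rightarrow> complex" and m :: "'p \<Rightarrow> complex" and \<kappa> :: complex
    and \<rho> :: "(('v \<Rightarrow> 'v, 'p) letter list \<Rightarrow> complex) set \<Rightarrow> 'e \<Rightarrow> 'e"
  assumes "fin_dim_complex_space scaleV BV"
    and "fin_dim_complex_space scaleE BE"
    and "pseudo_reflection_group scaleV G"
    and "indexes_hyperplanes scaleV G P H"
    and "\<And>i. i \<in> P \<Longrightarrow> defining_form scaleV (H i) (f i)"
    and "admissible scaleV G P H \<mu> m"
    and "brauer_representation scaleV G P H \<mu> m scaleE \<rho>"
  shows "flat_connection scaleV scaleE (complement P H)
           (brauer_connection scaleV G P H \<mu> m scaleE \<rho> f \<kappa>)
         \<and> invariant_connection G
           (\<lambda>w. \<rho> (brauer_class scaleV G P H \<mu> m (word_elem [Grp w]))) (complement P H)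
           (brauer_connection scaleV G P H \<mu> m scaleE \<rho> f \<kappa>)"
proof -
  let ?g = "\<lambda>w. \<rho> (brauer_class scaleV G P H \<mu> m (word_elem [Grp w]))"
  let ?e = "\<lambda>i. \<rho> (brauer_class scaleV G P H \<mu> m (word_elem [Hyp i]))"
  interpret V: fin_dim_complex_space scaleV BV by fact
  interpret E: fin_dim_complex_space scaleE BE by fact
  interpret reflection_arrangement scaleV BV G P H f
    by unfold_locales (use assms in auto)
  interpret rep: brauer_rep scaleV G P H \<mu> m scaleE \<rho>
    by (intro brauer_rep.intro finite_G subgroup_G assms)
  interpret normed_brauer_operators scaleV BV G P H f scaleE \<mu> ?g ?e BE \<kappa>
  proof (intro normed_brauer_operators.intro brauer_operators.intro brauer_operators_axioms.intro)
    show "reflection_arrangement scaleV BV G P H f" "vector_space scaleE"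
      by unfold_locales
    show "fin_dim_complex_space scaleE BE" by fact
    \<comment> \<open>\<open>admissible\<close> compares two reflections of \<open>G\<close>, so the
      conjugate has to be recognized as one first.\<close>
    show "\<mu> (w \<circ> s \<circ> inv_into UNIV w) = \<mu> s" if "w \<in> G" "s \<in> reflections scaleV G" for w s
      using assms(6) that reflection_conj[OF that] unfolding admissible_def by metis
  qed (fold rep.\<phi>_def, auto intro: rep.\<phi>_linear rep.\<phi>_group_mult rep.\<phi>_group_one
      rep.\<phi>_equivariant rep.\<phi>_commute rep.\<phi>_product)
  have "brauer_connection scaleV G P H \<mu> m scaleE \<rho> f \<kappa> = \<Omega>"
    by (simp add: fun_eq_iff brauer_connection_def \<Omega>_def X_def)
  then show ?thesis using flat_\<Omega> invariant_\<Omega> by simp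
qed

end
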